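(* Let $A$ be an $n\times n$ matrix with entries $A(i,j)\in\{0,1\}$ and with no zero rows and no zero columns. Let $\mathcal O_A$ be the Cuntz–Krieger algebra, i.e. a $C^*$-algebra generated by partial isometries $S_1,\dots,S_n$ acting on a Hilbert space whose support projections $Q_i=S_i^*S_i$ and range projections $P_i=S_iS_i^*$ satisfy $P_iP_j=0$ for $i\neq j$ and $Q_i=\sum_{r=1}^nA(i,r)P_r$ for $i,j\in\{1,\dots,n\}$. Let $\mathcal F_A\subset\mathcal O_A$ and $S\in\mathcal O_A$ be as defined in the context. Then $$\mathcal O_A=C^*(\mathcal F_A,S)\cong\mathcal F_A\times_\delta\mathbb Z,$$ where the isomorphism $\varphi:C^*(\mathcal F_A,S)\to\mathcal F_A\times_\delta\mathbb Z$ is such that $\varphi(S)=\hat U$ and $\varphi(a)=\hat a$ for all $a\in\mathcal F_A$, $\hat a$ and $\hat U$ being the canonical images of $a\in\mathcal F_A$ and $U$ in $\mathcal F_A\times_\delta\mathbb Z$, and where $\delta,\delta_*:\mathcal F_A\to\mathcal F_A$ are given by $\delta(\cdot)=S(\cdot)S^*$ and $\delta_*(\cdot)=S^*(\cdot)S$.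
   Context: The sum $\sum_iP_i$ is the unit of $\mathcal O_A$. For a multiindex $\mu=(i_1,\dots,i_k)$ with $i_j\in\{1,\dots,n\}$ put $|\mu|=k$ and $S_\mu=S_{i_1}\cdots S_{i_k}$; also $S_\emptyset=1$. $\mathcal F_A$ is the $C^*$-algebra generated by all elements $S_\mu P_iS_\nu^*$ with $|\mu|=|\nu|=k$, $k=0,1,\dots$, $i\in\{1,\dots,n\}$. Put $\alpha(P_i)=\sum_{j=1}^nS_jP_iS_j^*$, $\alpha(Q_i)=\sum_{r=1}^nA(i,r)\alpha(P_r)$, and $\alpha(Q)=\sum_{i=1}^n\alpha(Q_i)$, where $Q=\sum_{i=1}^nQ_i$. Then $\alpha(Q)\in\mathcal F_A$ and $\alpha(Q)\ge1$, and $$S=\alpha(Q)^{-1/2}\sum_{i=1}^nS_i .$$ $S$ is an isometry with $S\mathcal F_AS^*\subset\mathcal F_A$ and $S^*\mathcal F_AS\subset\mathcal F_A$, so $\delta$ is an endomorphism of $\mathcal F_A$ and $\delta_*$ is a complete transfer operator for $(\mathcal F_A,\delta)$. $C^*(\mathcal F_A,S)$ is the $C^*$-algebra generated by $\mathcal F_A$ and $S$. For a unital $C^*$-algebra $\mathcal A$ and a $*$-endomorphism $\delta$ of $\mathcal A$ (not necessarily unital), a transfer operator is a continuous positive linear map $\delta_*:\mathcal A\to\mathcal A$ with $\delta_*(\delta(a)b)=a\delta_*(b)$ for $a,b\in\mathcal A$; it is complete if $\delta\delta_*(a)=\delta(1)a\delta(1)$ for all $a\in\mathcal A$, and a complete one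 is unique if it exists. In that case the crossed product $\mathcal A\times_\delta\mathbb Z$ is the universal unital $C^*$-algebra generated by a copy of $\mathcal A$ and a partial isometry $U$ subject to the relations $\delta(a)=UaU^*$, $\delta_*(a)=U^*aU$ for $a\in\mathcal A$.
   Formalization: O_A is taken to be the universal C*-algebra for the stated relations together with ΣP_i = 1; for an arbitrary family of partial isometries the claim fails, e.g. n = 1, A = [1], S_1 = 1, where O_A = F_A = C but the crossed product is C(T). *)

theory Defs
  imports "HOL-Analysis.Analysis" "HOL-Library.Poly_Mapping"
begin

section \<open>Unital C*-algebras\<close>

class cstar_algebra = real_normed_algebra_1 + banach +
  fixes scaleC :: "complex \<Rightarrow> 'a \<Rightarrow> 'a" (infixr "*\<^sub>C" 75)
    and star :: "'a \<Rightarrow> 'a" ("_\<^sup>\<star>" [1000] 999)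
  assumes scaleC_add_right: "c *\<^sub>C (x + y) = c *\<^sub>C x + c *\<^sub>C y"
    and scaleC_add_left: "(c + d) *\<^sub>C x = c *\<^sub>C x + d *\<^sub>C x"
    and scaleC_scaleC: "c *\<^sub>C (d *\<^sub>C x) = (c * d) *\<^sub>C x"
    and scaleR_scaleC: "r *\<^sub>R x = complex_of_real r *\<^sub>C x"
    and mult_scaleC_left: "(c *\<^sub>C x) * y = c *\<^sub>C (x * y)"
    and mult_scaleC_right: "x * (c *\<^sub>C y) = c *\<^sub>C (x * y)"
    and norm_scaleC: "norm (c *\<^sub>C x) = cmod c * norm x"
    and star_add: "(x + y)\<^sup>\<star> = x\<^sup>\<star> + y\<^sup>\<star>"
    and star_scaleC: "(c *\<^sub>C x)\<^sup>\<star> = cnj c *\<^sub>C x\<^sup>\<star>"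
    and star_mult: "(x * y)\<^sup>\<star> = y\<^sup>\<star> * x\<^sup>\<star>"
    and star_star: "(x\<^sup>\<star>)\<^sup>\<star> = x"
    and norm_star_mult_self: "norm (x\<^sup>\<star> * x) = (norm x)\<^sup>2"

definition cstar_subalgebra :: "'a::cstar_algebra set \<Rightarrow> bool" where
  "cstar_subalgebra B \<longleftrightarrow> closed B \<and> 0 \<in> B \<and>
     (\<forall>x\<in>B. \<forall>y\<in>B. x + y \<in> B \<and> x * y \<in> B) \<and>
     (\<forall>c. \<forall>x\<in>B. c *\<^sub>C x \<in> B) \<and> (\<forall>x\<in>B. x\<^sup>\<star> \<in> B)"

definition cstar_generated :: "'a::cstar_algebra set \<Rightarrow> 'a set" where
  "cstar_generated X = \<Inter>{B. cstar_subalgebra B \<and> X \<subseteq> B}"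

text \<open>Spectrum and positivity relative to a C*-subalgebra \<open>B\<close> containing the unit.\<close>

definition spectrum_in :: "'a::cstar_algebra set \<Rightarrow> 'a \<Rightarrow> complex set" where
  "spectrum_in B a =
     {l. \<not> (\<exists>b\<in>B. b * (l *\<^sub>C 1 - a) = 1 \<and> (l *\<^sub>C 1 - a) * b = 1)}"

definition positive_in :: "'a::cstar_algebra set \<Rightarrow> 'a \<Rightarrow> bool" where
  "positive_in B a \<longleftrightarrow> a \<in> B \<and> a\<^sup>\<star> = a \<and> spectrum_in B a \<subseteq> complex_of_real ` {0..}"

text \<open>The element \<open>a\<^sup>-\<^sup>1\<^sup>/\<^sup>2\<close>, for \<open>a\<close> positive and invertible.\<close>

definition inverse_sqrt :: "'a::cstar_algebra \<Rightarrow> 'a" where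
  "inverse_sqrt a = (THE b. positive_in UNIV b \<and> b * b * a = 1 \<and> a * (b * b) = 1)"

definition star_hom_on :: "'a::cstar_algebra set \<Rightarrow> ('a \<Rightarrow> 'b::cstar_algebra) \<Rightarrow> bool" where
  "star_hom_on B f \<longleftrightarrow>
     (\<forall>x\<in>B. \<forall>y\<in>B. f (x + y) = f x + f y \<and> f (x * y) = f x * f y) \<and>
     (\<forall>c. \<forall>x\<in>B. f (c *\<^sub>C x) = c *\<^sub>C f x) \<and> (\<forall>x\<in>B. f (x\<^sup>\<star>) = (f x)\<^sup>\<star>)"

definition star_isomorphism ::
    "'a::cstar_algebra set \<Rightarrow> 'b::cstar_algebra set \<Rightarrow> ('a \<Rightarrow> 'b) \<Rightarrow> bool" where
  "star_isomorphism B C f \<longleftrightarrow> star_hom_on B f \<and> bij_betw f B C"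

definition star_endomorphism :: "'a::cstar_algebra set \<Rightarrow> ('a \<Rightarrow> 'a) \<Rightarrow> bool" where
  "star_endomorphism B d \<longleftrightarrow> star_hom_on B d \<and> d ` B \<subseteq> B"

section \<open>Transfer operators\<close>

definition transfer_operator ::
    "'a::cstar_algebra set \<Rightarrow> ('a \<Rightarrow> 'a) \<Rightarrow> ('a \<Rightarrow> 'a) \<Rightarrow> bool" where
  "transfer_operator B d t \<longleftrightarrow> t ` B \<subseteq> B \<and> continuous_on B t \<and>
     (\<forall>x\<in>B. \<forall>y\<in>B. t (x + y) = t x + t y) \<and> (\<forall>c. \<forall>x\<in>B. t (c *\<^sub>C x) = c *\<^sub>C t x) \<and>
     (\<forall>x. positive_in B x \<longrightarrow> positive_in B (t x)) \<and>
     (\<forall>a\<in>B. \<forall>b\<in>B. t (d a * b) = a * t b)"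

definition complete_transfer_operator ::
    "'a::cstar_algebra set \<Rightarrow> ('a \<Rightarrow> 'a) \<Rightarrow> ('a \<Rightarrow> 'a) \<Rightarrow> bool" where
  "complete_transfer_operator B d t \<longleftrightarrow> transfer_operator B d t \<and>
     (\<forall>a\<in>B. d (t a) = d 1 * a * d 1)"

section \<open>Universal unital C*-algebras on generators and relations\<close>

text \<open>The free unital *-algebra on \<open>'g\<close> is the monoid algebra over the complex numbers of the free
  monoid on the letters \<open>(x, False)\<close>, standing for \<open>x\<close>, and \<open>(x, True)\<close>, standing for \<open>x\<^sup>\<star>\<close>.
  The monoid is written additively, so that multiplication in the type of finitely supported
  functions is the convolution product and \<open>1\<close> is the empty word.\<close>

datatype 'g star_word = Word (letters: "('g \<times> bool) list")

instantiation star_word :: (type) monoid_add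
begin

definition zero_star_word :: "'a star_word" where
  "0 = Word []"

definition plus_star_word :: "'a star_word \<Rightarrow> 'a star_word \<Rightarrow> 'a star_word" where
  "v + w = Word (letters v @ letters w)"

instance
  by standard (auto simp: zero_star_word_def plus_star_word_def)

end

type_synonym 'g free_star_alg = "'g star_word \<Rightarrow>\<^sub>0 complex"

definition word_star :: "'g star_word \<Rightarrow> 'g star_word" where
  "word_star w = Word (rev (map (\<lambda>(x, s). (x, \<not> s)) (letters w)))"

definition gen :: "'g \<Rightarrow> 'g free_star_alg" where
  "gen x = Poly_Mapping.single (Word [(x, False)]) 1"

definition free_scale :: "complex \<Rightarrow> 'g free_star_alg \<Rightarrow> 'g free_star_alg" where
  "free_scale c x = Poly_Mapping.single 0 c * x"

definition free_star :: "'g free_star_alg \<Rightarrow> 'g free_star_alg" where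
  "free_star x = (\<Sum>w\<in>Poly_Mapping.keys x.
     Poly_Mapping.single (word_star w) (cnj (Poly_Mapping.lookup x w)))"

definition free_on :: "'g set \<Rightarrow> 'g free_star_alg set" where
  "free_on G = {x. \<forall>w\<in>Poly_Mapping.keys x. fst ` set (letters w) \<subseteq> G}"

definition eval_word :: "('g \<Rightarrow> 'a::cstar_algebra) \<Rightarrow> 'g star_word \<Rightarrow> 'a" where
  "eval_word g w = prod_list (map (\<lambda>(x, s). if s then (g x)\<^sup>\<star> else g x) (letters w))"

definition eval_free :: "('g \<Rightarrow> 'a::cstar_algebra) \<Rightarrow> 'g free_star_alg \<Rightarrow> 'a" where
  "eval_free g x = (\<Sum>w\<in>Poly_Mapping.keys x. Poly_Mapping.lookup x w *\<^sub>C eval_word g w)"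

definition cstar_seminorm :: "('g free_star_alg \<Rightarrow> real) \<Rightarrow> bool" where
  "cstar_seminorm p \<longleftrightarrow>
     (\<forall>x y. p (x + y) \<le> p x + p y) \<and> (\<forall>c x. p (free_scale c x) = cmod c * p x) \<and>
     (\<forall>x y. p (x * y) \<le> p x * p y) \<and> (\<forall>x. p (free_star x * x) = (p x)\<^sup>2)"

text \<open>\<open>universal_cstar G R g\<close>: the C*-algebra \<open>'a\<close>, together with the elements \<open>g x\<close> for \<open>x \<in> G\<close>,
  is the universal unital C*-algebra generated by \<open>G\<close> subject to the relations \<open>r = 0\<close> for
  \<open>r \<in> R\<close>. As usual, this is the Hausdorff completion of the free unital *-algebra on \<open>G\<close> in the
  largest C*-seminorm vanishing on \<open>R\<close>. Each C*-seminorm that vanishes on \<open>R\<close> comes from a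
  realization of the relations in some C*-algebra, so no quantification over types is needed;
  the universal property with respect to all C*-algebras is derived in \<open>universal_cstar_hom\<close>.\<close>

definition universal_cstar ::
    "'g set \<Rightarrow> 'g free_star_alg set \<Rightarrow> ('g \<Rightarrow> 'a::cstar_algebra) \<Rightarrow> bool" where
  "universal_cstar G R g \<longleftrightarrow>
     (\<forall>r\<in>R. eval_free g r = 0) \<and>
     cstar_generated (insert 1 (g ` G)) = UNIV \<and>
     (\<forall>p. cstar_seminorm p \<and> (\<forall>r\<in>R. p r = 0) \<longrightarrow>
        (\<forall>x\<in>free_on G. p x \<le> norm (eval_free g x)))"

section \<open>The crossed product by an endomorphism with a complete transfer operator\<close>

datatype 'a crossed_gen = Elt 'a | PIso

definition crossed_relators ::
    "'a::cstar_algebra set \<Rightarrow> ('a \<Rightarrow> 'a) \<Rightarrow> ('a \<Rightarrow> 'a) \<Rightarrow> 'a crossed_gen free_star_alg set" where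
  "crossed_relators B d t =
     {gen (Elt (a + b)) - (gen (Elt a) + gen (Elt b)) |a b. a \<in> B \<and> b \<in> B} \<union>
     {gen (Elt (c *\<^sub>C a)) - free_scale c (gen (Elt a)) |c a. a \<in> B} \<union>
     {gen (Elt (a * b)) - gen (Elt a) * gen (Elt b) |a b. a \<in> B \<and> b \<in> B} \<union>
     {gen (Elt (a\<^sup>\<star>)) - free_star (gen (Elt a)) |a. a \<in> B} \<union>
     {gen (Elt 1) - 1} \<union>
     {gen PIso * free_star (gen PIso) * gen PIso - gen PIso} \<union>
     {gen (Elt (d a)) - gen PIso * gen (Elt a) * free_star (gen PIso) |a. a \<in> B} \<union>
     {gen (Elt (t a)) - free_star (gen PIso) * gen (Elt a) * gen PIso |a. a \<in> B}"

text \<open>\<open>crossed_product B d t \<iota> U\<close>: the C*-algebra \<open>'b\<close> is the crossed product of the unital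
  C*-algebra \<open>B\<close> by the endomorphism \<open>d\<close> with complete transfer operator \<open>t\<close>, and \<open>\<iota> a\<close>
  (for \<open>a \<in> B\<close>) and \<open>U\<close> are the canonical images of \<open>a\<close> and of the partial isometry.\<close>

definition crossed_product ::
    "'a::cstar_algebra set \<Rightarrow> ('a \<Rightarrow> 'a) \<Rightarrow> ('a \<Rightarrow> 'a) \<Rightarrow> ('a \<Rightarrow> 'b::cstar_algebra) \<Rightarrow> 'b \<Rightarrow> bool" where
  "crossed_product B d t \<iota> U \<longleftrightarrow>
     universal_cstar (Elt ` B \<union> {PIso}) (crossed_relators B d t) (case_crossed_gen \<iota> U)"

section \<open>Cuntz--Krieger algebras\<close>

text \<open>The generator with index \<open>i\<close> stands for \<open>S\<^sub>i\<close>, and \<open>free_range i\<close> for \<open>P\<^sub>i\<close>.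
  The last relation says that the sum of the \<open>P\<^sub>i\<close> is the unit.\<close>

definition free_range :: "'g \<Rightarrow> 'g free_star_alg" where
  "free_range i = gen i * free_star (gen i)"

definition ck_relators :: "nat \<Rightarrow> (nat \<Rightarrow> nat \<Rightarrow> nat) \<Rightarrow> nat free_star_alg set" where
  "ck_relators n A =
     {gen i * free_star (gen i) * gen i - gen i |i. i \<in> {1..n}} \<union>
     {free_range i * free_range j |i j. i \<in> {1..n} \<and> j \<in> {1..n} \<and> i \<noteq> j} \<union>
     {free_star (gen i) * gen i - (\<Sum>r=1..n. of_nat (A i r) * free_range r) |i. i \<in> {1..n}} \<union>
     {(\<Sum>i=1..n. free_range i) - 1}"

definition cuntz_krieger :: "nat \<Rightarrow> (nat \<Rightarrow> nat \<Rightarrow> nat) \<Rightarrow> (nat \<Rightarrow> 'a::cstar_algebra) \<Rightarrow> bool" where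
  "cuntz_krieger n A S \<longleftrightarrow> universal_cstar {1..n} (ck_relators n A) S"

definition ck_P :: "(nat \<Rightarrow> 'a::cstar_algebra) \<Rightarrow> nat \<Rightarrow> 'a" where
  "ck_P S i = S i * (S i)\<^sup>\<star>"

definition ck_word :: "(nat \<Rightarrow> 'a::cstar_algebra) \<Rightarrow> nat list \<Rightarrow> 'a" where
  "ck_word S \<mu> = prod_list (map S \<mu>)"

definition ck_core :: "nat \<Rightarrow> (nat \<Rightarrow> 'a::cstar_algebra) \<Rightarrow> 'a set" where
  "ck_core n S = cstar_generated
     {ck_word S \<mu> * ck_P S i * (ck_word S \<nu>)\<^sup>\<star> |\<mu> \<nu> i.
        set \<mu> \<subseteq> {1..n} \<and> set \<nu> \<subseteq> {1..n} \<and> length \<mu> = length \<nu> \<and> i \<in> {1..n}}"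

definition ck_alpha_P :: "nat \<Rightarrow> (nat \<Rightarrow> 'a::cstar_algebra) \<Rightarrow> nat \<Rightarrow> 'a" where
  "ck_alpha_P n S i = (\<Sum>j=1..n. S j * ck_P S i * (S j)\<^sup>\<star>)"

definition ck_alpha_Q :: "nat \<Rightarrow> (nat \<Rightarrow> nat \<Rightarrow> nat) \<Rightarrow> (nat \<Rightarrow> 'a::cstar_algebra) \<Rightarrow> nat \<Rightarrow> 'a" where
  "ck_alpha_Q n A S i = (\<Sum>r=1..n. of_nat (A i r) * ck_alpha_P n S r)"

definition ck_isometry :: "nat \<Rightarrow> (nat \<Rightarrow> nat \<Rightarrow> nat) \<Rightarrow> (nat \<Rightarrow> 'a::cstar_algebra) \<Rightarrow> 'a" where
  "ck_isometry n A S = inverse_sqrt (\<Sum>i=1..n. ck_alpha_Q n A S i) * (\<Sum>i=1..n. S i)"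

section \<open>Evaluation and the universal property\<close>

lemma scaleC_zero_left [simp]: "0 *\<^sub>C x = (0::'a::cstar_algebra)"
  using scaleC_add_left[of 0 0 x] by simp

lemma scaleC_zero_right [simp]: "c *\<^sub>C 0 = (0::'a::cstar_algebra)"
  using scaleC_add_right[of c "0::'a" 0] by simp

lemma scaleC_one [simp]: "1 *\<^sub>C x = (x::'a::cstar_algebra)"
  using scaleR_scaleC[of 1 x] by simp

lemma star_zero [simp]: "0\<^sup>\<star> = (0::'a::cstar_algebra)"
  using star_add[of "0::'a" 0] by simp

lemma star_one [simp]: "1\<^sup>\<star> = (1::'a::cstar_algebra)"
  by (metis mult.right_neutral mult.left_neutral star_mult star_star)

lemma scaleC_diff: "c *\<^sub>C (x - y) = c *\<^sub>C x - c *\<^sub>C (y::'a::cstar_algebra)"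
  by (metis add_diff_cancel diff_add_cancel scaleC_add_right)

lemma star_diff: "(x - y)\<^sup>\<star> = x\<^sup>\<star> - (y::'a::cstar_algebra)\<^sup>\<star>"
  by (metis add_diff_cancel diff_add_cancel star_add)

lemma norm_star [simp]: "norm (x\<^sup>\<star>) = norm (x::'a::cstar_algebra)"
proof -
  have le: "norm y \<le> norm (y\<^sup>\<star>)" for y :: 'a
  proof (cases "norm y = 0")
    case False
    have "norm y * norm y \<le> norm (y\<^sup>\<star>) * norm y"
      using norm_mult_ineq[of "y\<^sup>\<star>" y] by (simp add: norm_star_mult_self power2_eq_square)
    with False show ?thesis by simp
  qed simp
  from le[of x] le[of "x\<^sup>\<star>"] show ?thesis by (simp add: star_star)
qed

lemma eval_free_superset:
  assumes "finite K" "Poly_Mapping.keys x \<subseteq> K"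
  shows "eval_free g x = (\<Sum>w\<in>K. Poly_Mapping.lookup x w *\<^sub>C eval_word g w)"
  unfolding eval_free_def using assms
  by (intro sum.mono_neutral_left) (auto simp: in_keys_iff)

lemma eval_free_single [simp]: "eval_free g (Poly_Mapping.single w c) = c *\<^sub>C eval_word g w"
  by (subst eval_free_superset[of "{w}"]) auto

lemma eval_free_zero [simp]: "eval_free g 0 = 0"
  by (simp add: eval_free_def)

lemma eval_free_add [simp]: "eval_free g (x + y) = eval_free g x + eval_free g y"
proof -
  let ?K = "Poly_Mapping.keys x \<union> Poly_Mapping.keys y"
  have "Poly_Mapping.keys (x + y) \<subseteq> ?K" by (rule Poly_Mapping.keys_add)
  then show ?thesis
    by (subst (1 2 3) eval_free_superset[of ?K])
      (auto simp: lookup_add scaleC_add_left sum.distrib)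
qed

lemma eval_free_diff [simp]: "eval_free g (x - y) = eval_free g x - eval_free g y"
  by (metis add_diff_cancel diff_add_cancel eval_free_add)

lemma eval_free_sum [simp]: "eval_free g (\<Sum>i\<in>I. f i) = (\<Sum>i\<in>I. eval_free g (f i))"
  by (induction I rule: infinite_finite_induct) auto

lemma eval_word_zero [simp]: "eval_word g 0 = 1"
  by (simp add: eval_word_def zero_star_word_def)

lemma eval_word_plus: "eval_word g (v + w) = eval_word g v * eval_word g w"
  by (simp add: eval_word_def plus_star_word_def)

lemma eval_free_one [simp]: "eval_free g 1 = 1"
  by (simp flip: single_one)

lemma free_as_sum:
  "x = (\<Sum>w\<in>Poly_Mapping.keys x. Poly_Mapping.single w (Poly_Mapping.lookup x w))"
  by (rule poly_mapping_eqI)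
    (auto simp: lookup_sum lookup_single when_def in_keys_iff sum.If_cases sum.delta)

lemma free_induct [case_names zero single add]:
  assumes "P 0" "\<And>w c. P (Poly_Mapping.single w c)" "\<And>x y. P x \<Longrightarrow> P y \<Longrightarrow> P (x + y)"
  shows "P (x :: 'g free_star_alg)"
proof -
  have "P (\<Sum>w\<in>K. Poly_Mapping.single w (Poly_Mapping.lookup x w))" if "finite K" for K
    using that by (induction K) (auto intro: assms)
  then show ?thesis by (subst free_as_sum) simp
qed

lemma eval_free_mult [simp]: "eval_free g (x * y) = eval_free g x * eval_free g y"
proof (induction x rule: free_induct)
  case (single v c)
  show ?case
    by (induction y rule: free_induct)
      (auto simp: mult_single eval_word_plus mult_scaleC_left mult_scaleC_right scaleC_scaleC
        distrib_left mult.commute)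
qed (auto simp: distrib_right)

lemma eval_free_scale [simp]: "eval_free g (free_scale c x) = c *\<^sub>C eval_free g x"
  by (simp add: free_scale_def mult_scaleC_left)

lemma eval_word_star: "eval_word g (word_star w) = (eval_word g w)\<^sup>\<star>"
proof -
  have "prod_list (map (\<lambda>(x, s). if s then (g x)\<^sup>\<star> else g x) (rev (map (\<lambda>(x, s). (x, \<not> s)) l))) =
    (prod_list (map (\<lambda>(x, s). if s then (g x)\<^sup>\<star> else g x) l))\<^sup>\<star>" for l
    by (induction l) (auto simp: star_mult star_star)
  then show ?thesis by (simp add: eval_word_def word_star_def)
qed

lemma star_sum: "(\<Sum>i\<in>I. f i)\<^sup>\<star> = (\<Sum>i\<in>I. (f i :: 'a::cstar_algebra)\<^sup>\<star>)"
  by (induction I rule: infinite_finite_induct) (auto simp: star_add)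

lemma eval_free_star [simp]: "eval_free g (free_star x) = (eval_free g x)\<^sup>\<star>"
  unfolding free_star_def eval_free_sum eval_free_single
  by (simp add: eval_free_def eval_word_star star_sum star_scaleC)

lemma eval_free_gen [simp]: "eval_free g (gen x) = g x"
  by (simp add: gen_def eval_word_def)

lemma cstar_seminorm_eval: "cstar_seminorm (\<lambda>x. norm (eval_free g x))"
  unfolding cstar_seminorm_def
  by (auto simp: norm_scaleC norm_mult_ineq norm_star_mult_self norm_triangle_ineq)

lemma eval_free_of_nat [simp]: "eval_free g (of_nat k) = of_nat k"
  by (induction k) auto

lemma cuntz_krieger_relations:
  assumes "cuntz_krieger n A S"
  shows "\<And>i. i \<in> {1..n} \<Longrightarrow> S i * (S i)\<^sup>\<star> * S i = S i"
    and "\<And>i j. i \<in> {1..n} \<Longrightarrow> j \<in> {1..n} \<Longrightarrow> i \<noteq> j \<Longrightarrow> ck_P S i * ck_P S j = 0"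
    and "\<And>i. i \<in> {1..n} \<Longrightarrow> (S i)\<^sup>\<star> * S i = (\<Sum>r=1..n. of_nat (A i r) * ck_P S r)"
    and "(\<Sum>i=1..n. ck_P S i) = 1"
proof -
  have rel: "eval_free S r = 0" if "r \<in> ck_relators n A" for r
    using assms that by (auto simp: cuntz_krieger_def universal_cstar_def)
  have P [simp]: "eval_free S (free_range i) = ck_P S i" for i
    by (simp add: free_range_def ck_P_def)
  show "S i * (S i)\<^sup>\<star> * S i = S i" if "i \<in> {1..n}" for i
    using rel[of "gen i * free_star (gen i) * gen i - gen i"] that
    by (auto simp: ck_relators_def)
  show "ck_P S i * ck_P S j = 0" if "i \<in> {1..n}" "j \<in> {1..n}" "i \<noteq> j" for i j
    using rel[of "free_range i * free_range j"] that
    by (auto simp: ck_relators_def)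
  show "(S i)\<^sup>\<star> * S i = (\<Sum>r=1..n. of_nat (A i r) * ck_P S r)" if "i \<in> {1..n}" for i
    using rel[of "free_star (gen i) * gen i - (\<Sum>r=1..n. of_nat (A i r) * free_range r)"] that
    by (auto simp: ck_relators_def)
  show "(\<Sum>i=1..n. ck_P S i) = 1"
    using rel[of "(\<Sum>i=1..n. free_range i) - 1"] by (auto simp: ck_relators_def)
qed

lemma crossed_product_relations:
  assumes "crossed_product B d t \<iota> U"
  shows "star_hom_on B \<iota>" and "\<iota> 1 = 1" and "U * U\<^sup>\<star> * U = U"
    and "\<And>a. a \<in> B \<Longrightarrow> \<iota> (d a) = U * \<iota> a * U\<^sup>\<star>"
    and "\<And>a. a \<in> B \<Longrightarrow> \<iota> (t a) = U\<^sup>\<star> * \<iota> a * U"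
proof -
  let ?g = "case_crossed_gen \<iota> U"
  have rel: "eval_free ?g r = 0" if "r \<in> crossed_relators B d t" for r
    using assms that by (auto simp: crossed_product_def universal_cstar_def)
  have "\<iota> (a + b) = \<iota> a + \<iota> b" if "a \<in> B" "b \<in> B" for a b
  proof -
    have "eval_free ?g (gen (Elt (a + b)) - (gen (Elt a) + gen (Elt b))) = 0"
      by (rule rel) (use that in \<open>unfold crossed_relators_def, blast\<close>)
    then show ?thesis by simp
  qed
  moreover have "\<iota> (a * b) = \<iota> a * \<iota> b" if "a \<in> B" "b \<in> B" for a b
  proof -
    have "eval_free ?g (gen (Elt (a * b)) - gen (Elt a) * gen (Elt b)) = 0"
      by (rule rel) (use that in \<open>unfold crossed_relators_def, blast\<close>)
    then show ?thesis by simp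
  qed
  moreover have "\<iota> (c *\<^sub>C a) = c *\<^sub>C \<iota> a" if "a \<in> B" for a c
  proof -
    have "eval_free ?g (gen (Elt (c *\<^sub>C a)) - free_scale c (gen (Elt a))) = 0"
      by (rule rel) (use that in \<open>unfold crossed_relators_def, blast\<close>)
    then show ?thesis by simp
  qed
  moreover have "\<iota> (a\<^sup>\<star>) = (\<iota> a)\<^sup>\<star>" if "a \<in> B" for a
  proof -
    have "eval_free ?g (gen (Elt (a\<^sup>\<star>)) - free_star (gen (Elt a))) = 0"
      by (rule rel) (use that in \<open>unfold crossed_relators_def, blast\<close>)
    then show ?thesis by simp
  qed
  ultimately show "star_hom_on B \<iota>" by (auto simp: star_hom_on_def)
  show "\<iota> 1 = 1"
  proof -
    have "eval_free ?g (gen (Elt 1) - 1) = 0"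
      by (rule rel) (unfold crossed_relators_def, blast)
    then show ?thesis by simp
  qed
  show "U * U\<^sup>\<star> * U = U"
  proof -
    have "eval_free ?g (gen PIso * free_star (gen PIso) * gen PIso - gen PIso) = 0"
      by (rule rel) (unfold crossed_relators_def, blast)
    then show ?thesis by simp
  qed
  show "\<iota> (d a) = U * \<iota> a * U\<^sup>\<star>" if "a \<in> B" for a
  proof -
    have "eval_free ?g (gen (Elt (d a)) - gen PIso * gen (Elt a) * free_star (gen PIso)) = 0"
      by (rule rel) (use that in \<open>unfold crossed_relators_def, blast\<close>)
    then show ?thesis by simp
  qed
  show "\<iota> (t a) = U\<^sup>\<star> * \<iota> a * U" if "a \<in> B" for a
  proof -
    have "eval_free ?g (gen (Elt (t a)) - free_star (gen PIso) * gen (Elt a) * gen PIso) = 0"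
      by (rule rel) (use that in \<open>unfold crossed_relators_def, blast\<close>)
    then show ?thesis by simp
  qed
qed

lemma free_on_zero: "0 \<in> free_on G" and free_on_one: "1 \<in> free_on G"
  by (auto simp: free_on_def zero_star_word_def simp flip: single_one)

lemma free_on_single: "fst ` set (letters w) \<subseteq> G \<Longrightarrow> Poly_Mapping.single w c \<in> free_on G"
  by (auto simp: free_on_def)

lemma free_on_add: "x \<in> free_on G \<Longrightarrow> y \<in> free_on G \<Longrightarrow> x + y \<in> free_on G"
  using Poly_Mapping.keys_add[of x y] unfolding free_on_def by blast

lemma free_on_mult:
  assumes "x \<in> free_on G" "y \<in> free_on G"
  shows "x * y \<in> free_on G"
proof -
  have "fst ` set (letters w) \<subseteq> G" if w: "w \<in> Poly_Mapping.keys (x * y)" for w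
  proof -
    obtain u v where "w = u + v" "u \<in> Poly_Mapping.keys x" "v \<in> Poly_Mapping.keys y"
      using keys_mult[of x y] w by blast
    with assms show ?thesis by (fastforce simp: free_on_def plus_star_word_def)
  qed
  then show ?thesis by (simp add: free_on_def)
qed

lemma free_on_sum: "(\<And>i. i \<in> I \<Longrightarrow> f i \<in> free_on G) \<Longrightarrow> (\<Sum>i\<in>I. f i) \<in> free_on G"
  by (induction I rule: infinite_finite_induct) (auto simp: free_on_zero intro: free_on_add)

lemma free_on_star: "x \<in> free_on G \<Longrightarrow> free_star x \<in> free_on G"
  unfolding free_star_def
  by (intro free_on_sum free_on_single) (force simp: free_on_def word_star_def)

lemma free_on_scale: "x \<in> free_on G \<Longrightarrow> free_scale c x \<in> free_on G"
  unfolding free_scale_def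
  by (intro free_on_mult free_on_single) (auto simp: zero_star_word_def)

lemma free_on_diff: "x \<in> free_on G \<Longrightarrow> y \<in> free_on G \<Longrightarrow> x - y \<in> free_on G"
  using Poly_Mapping.keys_diff[of x y] unfolding free_on_def by blast

lemma free_on_gen: "i \<in> G \<Longrightarrow> gen i \<in> free_on G"
  unfolding gen_def by (intro free_on_single) auto

lemma tendsto_scaleC:
  fixes f :: "_ \<Rightarrow> 'a::cstar_algebra"
  assumes "(f \<longlongrightarrow> l) F"
  shows "((\<lambda>x. c *\<^sub>C f x) \<longlongrightarrow> c *\<^sub>C l) F"
proof -
  have "bounded_linear (\<lambda>x::'a. c *\<^sub>C x)"
  proof (rule bounded_linear_intro)
    show "norm (c *\<^sub>C x) \<le> norm x * cmod c" for x :: 'a by (simp add: norm_scaleC)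
  qed (auto simp: scaleC_add_right scaleR_scaleC scaleC_scaleC mult.commute)
  from bounded_linear.tendsto[OF this assms] show ?thesis .
qed

lemma tendsto_star:
  fixes f :: "_ \<Rightarrow> 'a::cstar_algebra"
  assumes "(f \<longlongrightarrow> l) F"
  shows "((\<lambda>x. (f x)\<^sup>\<star>) \<longlongrightarrow> l\<^sup>\<star>) F"
proof -
  have "bounded_linear (\<lambda>x::'a. x\<^sup>\<star>)"
  proof (rule bounded_linear_intro)
    show "norm (x\<^sup>\<star>) \<le> norm x * 1" for x :: 'a by simp
  qed (auto simp: star_add scaleR_scaleC star_scaleC)
  from bounded_linear.tendsto[OF this assms] show ?thesis .
qed

lemma universal_cstar_dense:
  fixes g :: "'g \<Rightarrow> 'a::cstar_algebra"
  assumes "universal_cstar G R g"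
  shows "closure (eval_free g ` free_on G) = UNIV"
proof -
  let ?D = "eval_free g ` free_on G"
  have lim: "l \<in> closure ?D" if "\<And>k. X k \<in> ?D" "X \<longlonglongrightarrow> l" for X l
    unfolding closure_sequential using that by auto
  have seq: "\<exists>X. (\<forall>k. X k \<in> ?D) \<and> X \<longlonglongrightarrow> l" if "l \<in> closure ?D" for l
    using that unfolding closure_sequential by auto
  have "cstar_subalgebra (closure ?D)"
    unfolding cstar_subalgebra_def
  proof (intro conjI ballI allI)
    have "eval_free g 0 \<in> ?D" by (intro imageI free_on_zero)
    then show "0 \<in> closure ?D" using closure_subset by fastforce
  next
    fix x y assume x: "x \<in> closure ?D" and y: "y \<in> closure ?D"
    from seq[OF x] obtain X where X: "\<And>k. X k \<in> ?D" "X \<longlonglongrightarrow> x" by blast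
    from seq[OF y] obtain Y where Y: "\<And>k. Y k \<in> ?D" "Y \<longlonglongrightarrow> y" by blast
    have D: "u + v \<in> ?D" "u * v \<in> ?D" if "u \<in> ?D" "v \<in> ?D" for u v
      using that by (auto simp flip: eval_free_add eval_free_mult
        intro!: imageI free_on_add free_on_mult)
    show "x + y \<in> closure ?D" by (rule lim[OF D(1)[OF X(1) Y(1)] tendsto_add[OF X(2) Y(2)]])
    show "x * y \<in> closure ?D" by (rule lim[OF D(2)[OF X(1) Y(1)] tendsto_mult[OF X(2) Y(2)]])
  next
    fix c x assume x: "x \<in> closure ?D"
    from seq[OF x] obtain X where X: "\<And>k. X k \<in> ?D" "X \<longlonglongrightarrow> x" by blast
    have D: "c *\<^sub>C u \<in> ?D" if "u \<in> ?D" for u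
      using that by (auto simp flip: eval_free_scale intro!: imageI free_on_scale)
    show "c *\<^sub>C x \<in> closure ?D" by (rule lim[OF D[OF X(1)] tendsto_scaleC[OF X(2)]])
  next
    fix x assume x: "x \<in> closure ?D"
    from seq[OF x] obtain X where X: "\<And>k. X k \<in> ?D" "X \<longlonglongrightarrow> x" by blast
    have D: "u\<^sup>\<star> \<in> ?D" if "u \<in> ?D" for u
      using that by (auto simp flip: eval_free_star intro!: imageI free_on_star)
    show "x\<^sup>\<star> \<in> closure ?D" by (rule lim[OF D[OF X(1)] tendsto_star[OF X(2)]])
  qed simp
  moreover have "insert 1 (g ` G) \<subseteq> ?D"
    using imageI[OF free_on_one, of "eval_free g" G] imageI[OF free_on_gen, of _ G "eval_free g"]
    by auto
  ultimately have "cstar_generated (insert 1 (g ` G)) \<subseteq> closure ?D"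
    unfolding cstar_generated_def using closure_subset by blast
  with assms show ?thesis by (auto simp: universal_cstar_def)
qed

lemma universal_cstar_hom:
  fixes g :: "'g \<Rightarrow> 'a::cstar_algebra" and h :: "'g \<Rightarrow> 'b::cstar_algebra"
  assumes univ: "universal_cstar G R g" and rel: "\<forall>r\<in>R. eval_free h r = 0"
  shows "\<exists>\<phi>. star_hom_on UNIV \<phi> \<and> \<phi> 1 = 1 \<and> (\<forall>x\<in>G. \<phi> (g x) = h x) \<and>
    (\<forall>x. norm (\<phi> x) \<le> norm x)"
proof -
  let ?D = "eval_free g ` free_on G"
  have le: "norm (eval_free h x) \<le> norm (eval_free g x)" if "x \<in> free_on G" for x
    using univ cstar_seminorm_eval[of h] rel that unfolding universal_cstar_def by fastforce
  define r where "r = inv_into (free_on G) (eval_free g)"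
  define \<psi> where "\<psi> y = eval_free h (r y)" for y
  have \<psi>: "\<psi> (eval_free g x) = eval_free h x" if x: "x \<in> free_on G" for x
  proof -
    have "r (eval_free g x) \<in> free_on G" "eval_free g (r (eval_free g x)) = eval_free g x"
      unfolding r_def using x by (auto intro: inv_into_into f_inv_into_f)
    then show ?thesis
      using le[of "r (eval_free g x) - x"] x by (simp add: \<psi>_def free_on_diff)
  qed
  have dist_le: "dist (\<psi> x) (\<psi> y) \<le> dist x y" if "x \<in> ?D" "y \<in> ?D" for x y
  proof -
    from that obtain u v where "x = eval_free g u" "u \<in> free_on G" "y = eval_free g v" "v \<in> free_on G"
      by blast
    then show ?thesis using le[of "u - v"] by (simp add: \<psi> dist_norm free_on_diff)
  qed
  have uc0: "uniformly_continuous_on ?D \<psi>"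
    unfolding uniformly_continuous_on_def using dist_le order.strict_trans1 by metis
  obtain \<phi> where uc: "uniformly_continuous_on (closure ?D) \<phi>"
    and ext: "\<And>x. x \<in> ?D \<Longrightarrow> \<psi> x = \<phi> x"
    by (rule uniformly_continuous_on_extension_on_closure[OF uc0]) metis
  have dense: "closure ?D = UNIV" by (rule universal_cstar_dense[OF univ])
  have cont: "isCont \<phi> x" for x
    using uniformly_continuous_imp_continuous[OF uc] dense
    by (simp add: continuous_on_eq_continuous_at)
  have \<phi>: "\<phi> (eval_free g x) = eval_free h x" if "x \<in> free_on G" for x
    using \<psi>[OF that] ext that by auto
  have approx: "\<exists>X. (\<forall>k. X k \<in> free_on G) \<and> (\<lambda>k. eval_free g (X k)) \<longlonglongrightarrow> x \<and>
      (\<lambda>k. eval_free h (X k)) \<longlonglongrightarrow> \<phi> x" for x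
  proof -
    from dense have "x \<in> closure ?D" by simp
    then obtain Y where Y: "\<forall>k. Y k \<in> ?D" "Y \<longlonglongrightarrow> x" unfolding closure_sequential by blast
    then have "\<forall>k. \<exists>u\<in>free_on G. Y k = eval_free g u" by blast
    then obtain X where X: "\<And>k. X k \<in> free_on G" "\<And>k. Y k = eval_free g (X k)" by metis
    have "(\<lambda>k. \<phi> (Y k)) \<longlonglongrightarrow> \<phi> x" by (rule isCont_tendsto_compose[OF cont Y(2)])
    moreover have "Y = (\<lambda>k. eval_free g (X k))" using X(2) by auto
    ultimately show ?thesis using X Y(2) \<phi> by (intro exI[of _ X]) simp
  qed
  have "\<phi> (x + y) = \<phi> x + \<phi> y \<and> \<phi> (x * y) = \<phi> x * \<phi> y" for x y
  proof -
    from approx[of x] obtain X where X: "\<And>k. X k \<in> free_on G"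
      "(\<lambda>k. eval_free g (X k)) \<longlonglongrightarrow> x" "(\<lambda>k. eval_free h (X k)) \<longlonglongrightarrow> \<phi> x" by blast
    from approx[of y] obtain Y where Y: "\<And>k. Y k \<in> free_on G"
      "(\<lambda>k. eval_free g (Y k)) \<longlonglongrightarrow> y" "(\<lambda>k. eval_free h (Y k)) \<longlonglongrightarrow> \<phi> y" by blast
    have "(\<lambda>k. \<phi> (eval_free g (X k + Y k))) \<longlonglongrightarrow> \<phi> (x + y)"
      unfolding eval_free_add by (intro isCont_tendsto_compose[OF cont] tendsto_add X Y)
    moreover have "(\<lambda>k. \<phi> (eval_free g (X k + Y k))) \<longlonglongrightarrow> \<phi> x + \<phi> y"
      by (subst \<phi>) (auto intro: free_on_add X Y tendsto_add)
    moreover have "(\<lambda>k. \<phi> (eval_free g (X k * Y k))) \<longlonglongrightarrow> \<phi> (x * y)"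
      unfolding eval_free_mult by (intro isCont_tendsto_compose[OF cont] tendsto_mult X Y)
    moreover have "(\<lambda>k. \<phi> (eval_free g (X k * Y k))) \<longlonglongrightarrow> \<phi> x * \<phi> y"
      by (subst \<phi>) (auto intro: free_on_mult X Y tendsto_mult)
    ultimately show ?thesis using LIMSEQ_unique by blast
  qed
  moreover have "\<phi> (c *\<^sub>C x) = c *\<^sub>C \<phi> x \<and> \<phi> (x\<^sup>\<star>) = (\<phi> x)\<^sup>\<star> \<and> norm (\<phi> x) \<le> norm x" for c x
  proof -
    from approx[of x] obtain X where X: "\<And>k. X k \<in> free_on G"
      "(\<lambda>k. eval_free g (X k)) \<longlonglongrightarrow> x" "(\<lambda>k. eval_free h (X k)) \<longlonglongrightarrow> \<phi> x" by blast
    have "(\<lambda>k. \<phi> (eval_free g (free_scale c (X k)))) \<longlonglongrightarrow> \<phi> (c *\<^sub>C x)"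
      unfolding eval_free_scale by (intro isCont_tendsto_compose[OF cont] tendsto_scaleC X)
    moreover have "(\<lambda>k. \<phi> (eval_free g (free_scale c (X k)))) \<longlonglongrightarrow> c *\<^sub>C \<phi> x"
      by (subst \<phi>) (auto intro: free_on_scale X tendsto_scaleC)
    moreover have "(\<lambda>k. \<phi> (eval_free g (free_star (X k)))) \<longlonglongrightarrow> \<phi> (x\<^sup>\<star>)"
      unfolding eval_free_star by (intro isCont_tendsto_compose[OF cont] tendsto_star X)
    moreover have "(\<lambda>k. \<phi> (eval_free g (free_star (X k)))) \<longlonglongrightarrow> (\<phi> x)\<^sup>\<star>"
      by (subst \<phi>) (auto intro: free_on_star X tendsto_star)
    moreover have "norm (\<phi> x) \<le> norm x"
      by (rule LIMSEQ_le[OF tendsto_norm[OF X(3)] tendsto_norm[OF X(2)]]) (use le X(1) in blast)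
    ultimately show ?thesis using LIMSEQ_unique by blast
  qed
  ultimately have "star_hom_on UNIV \<phi>" "\<forall>x. norm (\<phi> x) \<le> norm x" by (auto simp: star_hom_on_def)
  moreover have "\<phi> 1 = 1" using \<phi>[OF free_on_one] by simp
  moreover have "\<phi> (g x) = h x" if "x \<in> G" for x using \<phi>[OF free_on_gen[OF that]] by simp
  ultimately show ?thesis by blast
qed

end

theory Submission
  imports Defs
begin

text \<open>Why the theorem is true. The elements \<open>\<alpha>(P\<^sub>r)\<close> are mutually orthogonal projections with sum \<open>1\<close>, so
  \<open>\<alpha>(Q) = \<Sum>\<^sub>r c\<^sub>r \<alpha>(P\<^sub>r)\<close>, where \<open>c\<^sub>r \<ge> 1\<close> is the \<open>r\<close>-th column sum of \<open>A\<close>, is a diagonal element: its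
  powers are obtained by applying the power to the coefficients, and they stay in the core
  \<open>\<F>\<^sub>A\<close>. From \<open>V = \<alpha>(Q)\<^sup>-\<^sup>1\<^sup>/\<^sup>2 \<Sum>\<^sub>i S\<^sub>i\<close> one reads off \<open>V\<^sup>\<star>V = 1\<close> and, since \<open>P\<^sub>i S\<^sub>j = 0\<close> for \<open>i \<noteq> j\<close>,
  the key formula \<open>S\<^sub>i = P\<^sub>i \<alpha>(Q)\<^sup>1\<^sup>/\<^sup>2 V\<close> (lemma \<open>S_eq\<close>). It shows that the core and \<open>V\<close> generate \<open>\<O>\<^sub>A\<close>.
  Both \<open>a \<mapsto> V a V\<^sup>\<star>\<close> and \<open>a \<mapsto> V\<^sup>\<star> a V\<close> preserve the core, because they lengthen or shorten the two
  multiindices of a generator \<open>S\<^sub>\<mu> P\<^sub>i S\<^sub>\<nu>\<^sup>\<star>\<close> by the same amount.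

  For the universal property, let \<open>p\<close> be a C*-seminorm on the free *-algebra on the core and a
  letter \<open>U\<close> that vanishes on the relators of the crossed product. Put \<open>s\<^sub>i = P\<^sub>i \<alpha>(Q)\<^sup>1\<^sup>/\<^sup>2 U\<close>. The
  relations \<open>U a U\<^sup>\<star> = \<delta>(a)\<close> and \<open>U\<^sup>\<star> a U = \<delta>\<^sub>*(a)\<close> reduce \<open>s\<^sub>i a s\<^sub>j\<^sup>\<star>\<close> and \<open>s\<^sub>i\<^sup>\<star> s\<^sub>j\<close> to the elements
  \<open>S\<^sub>i a S\<^sub>j\<^sup>\<star>\<close> and \<open>S\<^sub>i\<^sup>\<star> S\<^sub>j\<close> of the core, so the \<open>s\<^sub>i\<close> satisfy the Cuntz--Krieger relations modulo the kernel
  of \<open>p\<close> (lemma \<open>lift_ck_relators\<close>). By the universality of \<open>\<O>\<^sub>A\<close>, on the *-algebra of the \<open>s\<^sub>i\<close> the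
  seminorm \<open>p\<close> is at most the norm of \<open>\<O>\<^sub>A\<close>. This *-algebra is dense for \<open>p\<close>: it contains the
  generators of the core modulo the kernel of \<open>p\<close>, on the core \<open>p\<close> is continuous, and
  \<open>U = \<alpha>(Q)\<^sup>-\<^sup>1\<^sup>/\<^sup>2 \<Sum>\<^sub>i s\<^sub>i\<close>. Hence \<open>p\<close> is at most the norm of \<open>\<O>\<^sub>A\<close> everywhere (lemma \<open>crossed_le\<close>), which says that \<open>\<O>\<^sub>A\<close>
  with \<open>V\<close> is the crossed product. Any other model is isomorphic to it by uniqueness of universal
  C*-algebras (lemma \<open>universal_cstar_unique\<close>).

  The facts about C*-algebras that this uses are: a C*-seminorm on a C*-algebra is at most the norm
  (\<open>cstar_seminorm_le_norm\<close>), compression by an isometry preserves positivity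
  (\<open>positive_in_conjugate\<close>), and a positive square root that is bounded below is unique
  (\<open>positive_sqrt_unique\<close>).
  They come from Neumann series, a square root of \<open>1 - y\<close> for \<open>\<parallel>y\<parallel> < 1\<close>, found as a fixed point of a contraction, and the
  element \<open>z + \<i> g\<close> made of two commuting self-adjoint elements.\<close>

section \<open>Scalars and C*-subalgebras\<close>

lemma scaleC_diff_left: "(c - d) *\<^sub>C x = c *\<^sub>C x - d *\<^sub>C (x::'a::cstar_algebra)"
  by (metis add_diff_cancel diff_add_cancel scaleC_add_left)

lemma scaleC_minus_one: "(- 1) *\<^sub>C x = - (x::'a::cstar_algebra)"
  using scaleC_diff_left[of 0 1 x] by simp

lemma scaleC_sum_right: "c *\<^sub>C (\<Sum>i\<in>I. f i) = (\<Sum>i\<in>I. c *\<^sub>C (f i :: 'a::cstar_algebra))"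
  by (induction I rule: infinite_finite_induct) (auto simp: scaleC_add_right)

lemma scaleC_of_nat: "of_nat k * x = of_nat k *\<^sub>C (x::'a::cstar_algebra)"
  by (induction k) (auto simp: algebra_simps scaleC_add_left)

lemma star_scaleR: "(r *\<^sub>R x)\<^sup>\<star> = r *\<^sub>R (x::'a::cstar_algebra)\<^sup>\<star>"
  by (simp add: scaleR_scaleC star_scaleC)

lemma cstar_subalgebraD:
  assumes "cstar_subalgebra B"
  shows "closed B" "0 \<in> B"
    "\<And>x y. x \<in> B \<Longrightarrow> y \<in> B \<Longrightarrow> x + y \<in> B" "\<And>x y. x \<in> B \<Longrightarrow> y \<in> B \<Longrightarrow> x * y \<in> B"
    "\<And>c x. x \<in> B \<Longrightarrow> c *\<^sub>C x \<in> B" "\<And>x. x \<in> B \<Longrightarrow> x\<^sup>\<star> \<in> B"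
    "\<And>r x. x \<in> B \<Longrightarrow> r *\<^sub>R x \<in> B" "\<And>x. x \<in> B \<Longrightarrow> - x \<in> B"
    "\<And>x y. x \<in> B \<Longrightarrow> y \<in> B \<Longrightarrow> x - y \<in> B"
proof -
  show "closed B" "0 \<in> B" and add: "\<And>x y. x \<in> B \<Longrightarrow> y \<in> B \<Longrightarrow> x + y \<in> B"
    and "\<And>x y. x \<in> B \<Longrightarrow> y \<in> B \<Longrightarrow> x * y \<in> B"
    and sc: "\<And>c x. x \<in> B \<Longrightarrow> c *\<^sub>C x \<in> B" and "\<And>x. x \<in> B \<Longrightarrow> x\<^sup>\<star> \<in> B"
    using assms by (auto simp: cstar_subalgebra_def)
  show "r *\<^sub>R x \<in> B" if "x \<in> B" for r x using sc[OF that] by (simp add: scaleR_scaleC)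
  show min: "- x \<in> B" if "x \<in> B" for x using sc[OF that, of "- 1"] by (simp add: scaleC_minus_one)
  show "x - y \<in> B" if "x \<in> B" "y \<in> B" for x y using add[OF that(1) min[OF that(2)]] by simp
qed

lemma cstar_subalgebra_sum:
  assumes "cstar_subalgebra B" "\<And>i. i \<in> I \<Longrightarrow> f i \<in> B"
  shows "(\<Sum>i\<in>I. f i) \<in> B"
  using assms(2) by (induction I rule: infinite_finite_induct)
    (auto intro: cstar_subalgebraD[OF assms(1)])

lemma cstar_subalgebra_generated: "cstar_subalgebra (cstar_generated X)"
  unfolding cstar_generated_def cstar_subalgebra_def[of "\<Inter>_"]
  by (auto intro: closed_Inter cstar_subalgebraD)

lemma cstar_generated_superset: "X \<subseteq> cstar_generated X"
  unfolding cstar_generated_def by blast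

lemma cstar_generated_minimal: "cstar_subalgebra B \<Longrightarrow> X \<subseteq> B \<Longrightarrow> cstar_generated X \<subseteq> B"
  unfolding cstar_generated_def by blast

lemma isCont_star: "isCont (\<lambda>x::'a::cstar_algebra. x\<^sup>\<star>) a"
  unfolding isCont_def by (intro tendsto_star tendsto_ident_at)

section \<open>Neumann series and square roots\<close>

text \<open>For commuting self-adjoint \<open>z\<close> and \<open>g\<close>, the element \<open>z + \<i> g\<close> behaves like the complex number with
  real part \<open>z\<close> and imaginary part \<open>g\<close>. Through the C*-identity it turns an identity \<open>z\<^sup>2 + g\<^sup>2 = c\<close> into norm bounds for \<open>z\<close>.\<close>

lemma commuting_selfadjoint_pair:
  fixes z g :: "'a::cstar_algebra"
  assumes "z\<^sup>\<star> = z" "g\<^sup>\<star> = g" "z * g = g * z"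
  shows "(z + \<i> *\<^sub>C g)\<^sup>\<star> * (z + \<i> *\<^sub>C g) = z * z + g * g"
    and "(z + \<i> *\<^sub>C g) * (z + \<i> *\<^sub>C g)\<^sup>\<star> = z * z + g * g"
    and "(z + \<i> *\<^sub>C g) + (z + \<i> *\<^sub>C g)\<^sup>\<star> = 2 *\<^sub>C z"
proof -
  have us: "(z + \<i> *\<^sub>C g)\<^sup>\<star> = z - \<i> *\<^sub>C g"
    using scaleC_diff_left[of 0 \<i> g] by (simp add: star_add star_scaleC assms)
  show "(z + \<i> *\<^sub>C g)\<^sup>\<star> * (z + \<i> *\<^sub>C g) = z * z + g * g"
    "(z + \<i> *\<^sub>C g) * (z + \<i> *\<^sub>C g)\<^sup>\<star> = z * z + g * g"
    unfolding us using assms(3) scaleC_minus_one[of "g * g"]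
    by (simp_all add: algebra_simps mult_scaleC_left mult_scaleC_right scaleC_scaleC
        scaleC_diff scaleC_add_right)
  show "(z + \<i> *\<^sub>C g) + (z + \<i> *\<^sub>C g)\<^sup>\<star> = 2 *\<^sub>C z"
    using scaleC_add_left[of 1 1 z] by (simp add: us)
qed

text \<open>The real part of \<open>z + \<i> g\<close> is at most its modulus, because a C*-norm is invariant under \<open>\<star>\<close>.\<close>

lemma norm_sq_le_norm_sum_squares:
  fixes z g :: "'a::cstar_algebra"
  assumes "z\<^sup>\<star> = z" "g\<^sup>\<star> = g" "z * g = g * z"
  shows "(norm z)\<^sup>2 \<le> norm (z * z + g * g)"
proof -
  let ?u = "z + \<i> *\<^sub>C g"
  note pair = commuting_selfadjoint_pair[OF assms]
  have "2 * norm z \<le> norm ?u + norm (?u\<^sup>\<star>)"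
    using norm_triangle_ineq[of ?u "?u\<^sup>\<star>"] unfolding pair(3) norm_scaleC by simp
  then have "(norm z)\<^sup>2 \<le> (norm ?u)\<^sup>2" by (intro power_mono) auto
  then show ?thesis unfolding norm_star_mult_self[symmetric] pair(1) .
qed

text \<open>The inverse is the fixed point of \<open>z \<mapsto> 1 + x z\<close>, so it lies in every closed subalgebra that
  contains \<open>x\<close>. The last clause is the usual bound \<open>\<parallel>b\<parallel> \<le> 1 / (1 - \<parallel>x\<parallel>)\<close>.\<close>

lemma cstar_neumann:
  fixes x :: "'a::cstar_algebra"
  assumes B: "cstar_subalgebra B" "1 \<in> B" "x \<in> B" and x: "norm x < 1"
  obtains b where "b \<in> B" "b * (1 - x) = 1" "(1 - x) * b = 1" "norm b * (1 - norm x) \<le> 1"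
proof -
  note sub = cstar_subalgebraD[OF B(1)]
  have X: "complete B" using sub(1) by (simp add: complete_eq_closed)
  have "\<exists>!z\<in>B. 1 + x * z = z"
  proof (rule Banach_fix[OF X _ norm_ge_zero x])
    show "B \<noteq> {}" "(\<lambda>z. 1 + x * z) ` B \<subseteq> B" using B sub by auto
    show "dist (1 + x * y) (1 + x * z) \<le> norm x * dist y z" for y z
      using norm_mult_ineq[of x "y - z"] by (simp add: dist_norm right_diff_distrib)
  qed
  then obtain b where b: "b \<in> B" "1 + x * b = b" by blast
  have "\<exists>!z\<in>B. 1 + z * x = z"
  proof (rule Banach_fix[OF X _ norm_ge_zero x])
    show "B \<noteq> {}" "(\<lambda>z. 1 + z * x) ` B \<subseteq> B" using B sub by auto
    show "dist (1 + y * x) (1 + z * x) \<le> norm x * dist y z" for y z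
      using norm_mult_ineq[of "y - z" x] by (simp add: dist_norm left_diff_distrib mult.commute)
  qed
  then obtain c where c: "c \<in> B" "1 + c * x = c" by blast
  have 1: "(1 - x) * b = 1" using b(2) by (simp add: algebra_simps)
  have "c * (1 - x) = 1" using c(2) by (simp add: algebra_simps)
  with 1 have "c = b" by (metis mult.assoc mult.left_neutral mult.right_neutral)
  with \<open>c * (1 - x) = 1\<close> have 2: "b * (1 - x) = 1" by simp
  have "norm b \<le> 1 + norm x * norm b"
    using norm_triangle_ineq[of 1 "x * b"] norm_mult_ineq[of x b] b(2) by simp
  then have "norm b * (1 - norm x) \<le> 1" by (simp add: algebra_simps)
  with b(1) 2 1 that show ?thesis by blast
qed

text \<open>If \<open>v = 1 - z\<close>, then \<open>v\<^sup>2 = 1 - y\<close> says that \<open>z\<close> is a fixed point of \<open>z \<mapsto> (y + z\<^sup>2) / 2\<close>. On the ball of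
  radius \<open>r = 1 - sqrt (1 - \<parallel>y\<parallel>)\<close> this map is a contraction with constant \<open>r\<close>, and it preserves
  self-adjointness and commutation with everything that commutes with \<open>y\<close>; these are closed
  conditions, so the fixed point inherits them.\<close>

lemma selfadjoint_sqrt:
  fixes y :: "'a::cstar_algebra"
  assumes B: "cstar_subalgebra B" "1 \<in> B" "y \<in> B" and y: "y\<^sup>\<star> = y" "norm y < 1"
  obtains v where "v \<in> B" "v\<^sup>\<star> = v" "v * v = 1 - y" "\<And>q. q * y = y * q \<Longrightarrow> q * v = v * q"
proof -
  note sub = cstar_subalgebraD[OF B(1)]
  define r where "r = 1 - sqrt (1 - norm y)"
  have r: "0 \<le> r" "r < 1" using y(2) by (auto simp: r_def)
  have "(sqrt (1 - norm y))\<^sup>2 = 1 - norm y" using y(2) by simp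
  then have r2: "norm y + r * r = 2 * r" by (simp add: r_def power2_eq_square algebra_simps)
  define X where "X = B \<inter> {z. norm z \<le> r} \<inter> {z. z\<^sup>\<star> = z} \<inter> {z. \<forall>q. q * y = y * q \<longrightarrow> q * z = z * q}"
  define f where "f z = (1/2) *\<^sub>R (y + z * z)" for z
  have "closed {z. z\<^sup>\<star> = (z::'a)}"
    by (intro closed_Collect_eq continuous_at_imp_continuous_on ballI isCont_star continuous_on_id)
  moreover have "closed {z. \<forall>q. q * y = y * q \<longrightarrow> q * z = z * q}"
    by (intro closed_Collect_all closed_Collect_imp closed_Collect_eq continuous_intros) simp
  moreover have "closed {z::'a. norm z \<le> r}" by (intro closed_Collect_le continuous_intros)
  ultimately have X: "complete X"
    unfolding X_def complete_eq_closed by (intro closed_Int sub(1))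
  have "\<exists>!z\<in>X. f z = z"
  proof (rule Banach_fix[OF X _ r])
    have "0 \<in> X" using r sub by (auto simp: X_def)
    then show "X \<noteq> {}" by blast
    show "f ` X \<subseteq> X"
    proof safe
      fix z assume z: "z \<in> X"
      then have zr: "norm z \<le> r" and zB: "z \<in> B" and zs: "z\<^sup>\<star> = z"
        and zc: "\<And>q. q * y = y * q \<Longrightarrow> q * z = z * q"
        unfolding X_def by blast+
      have "norm (y + z * z) \<le> norm y + norm z * norm z"
        using norm_triangle_ineq[of y "z * z"] norm_mult_ineq[of z z] by linarith
      also have "norm z * norm z \<le> r * r" using zr r(1) by (intro mult_mono) auto
      finally have "norm (f z) \<le> r" using r2 by (simp add: f_def)
      moreover have "q * f z = f z * q" if "q * y = y * q" for q
      proof -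
        have "q * (z * z) = z * z * q" by (metis mult.assoc zc[OF that])
        with that show ?thesis by (simp add: f_def distrib_left distrib_right)
      qed
      moreover have "f z \<in> B" unfolding f_def using zB B(3) sub(3,4,7) by simp
      moreover have "(f z)\<^sup>\<star> = f z"
        using zs y(1) by (simp add: f_def star_scaleR star_add star_mult)
      ultimately show "f z \<in> X" unfolding X_def by blast
    qed
    fix u v assume uv: "u \<in> X" "v \<in> X"
    \<comment> \<open>The noncommutative form of \<open>u\<^sup>2 - v\<^sup>2 = (u + v) (u - v)\<close>.\<close>
    have "f u - f v = (1/2) *\<^sub>R (u * (u - v) + (u - v) * v)"
      by (simp add: f_def algebra_simps)
    then have "norm (f u - f v) \<le> (1/2) * (norm (u * (u - v)) + norm ((u - v) * v))"
      using norm_triangle_ineq[of "u * (u - v)" "(u - v) * v"] by simp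
    also have "norm (u * (u - v)) \<le> r * norm (u - v)"
      using uv by (intro order.trans[OF norm_mult_ineq] mult_right_mono) (auto simp: X_def)
    also have "norm ((u - v) * v) \<le> norm (u - v) * r"
      using uv by (intro order.trans[OF norm_mult_ineq] mult_left_mono) (auto simp: X_def)
    finally show "dist (f u) (f v) \<le> r * dist u v" by (simp add: dist_norm mult.commute)
  qed
  then obtain z where z: "z \<in> X" "f z = z" by blast
  have "y + z * z = 2 *\<^sub>R f z" by (simp add: f_def)
  then have "z * z = z + z - y" using z(2) by (simp add: scaleR_2 algebra_simps)
  then have "(1 - z) * (1 - z) = 1 - y" by (simp add: algebra_simps)
  moreover have "z \<in> B" "z\<^sup>\<star> = z" and zc: "\<And>q. q * y = y * q \<Longrightarrow> q * z = z * q"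
    using z(1) unfolding X_def by blast+
  then have "1 - z \<in> B" "(1 - z)\<^sup>\<star> = 1 - z" using B sub by (auto simp: star_diff)
  moreover have "q * (1 - z) = (1 - z) * q" if "q * y = y * q" for q
    using zc[OF that] by (simp add: right_diff_distrib left_diff_distrib)
  ultimately show ?thesis using that by blast
qed

text \<open>A self-adjoint \<open>b\<close> with \<open>\<parallel>b\<parallel> < 1\<close> is the real part of the unitary \<open>b + \<i> sqrt (1 - b\<^sup>2)\<close>, and a
  C*-seminorm is at most \<open>1\<close> on unitaries. Hence it is at most the norm on self-adjoint elements, and on all
  elements by the C*-identity.\<close>

lemma cstar_seminorm_le_norm:
  fixes q :: "'a::cstar_algebra \<Rightarrow> real"
  assumes B: "cstar_subalgebra B" "1 \<in> B" "a \<in> B"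
    and add: "\<And>x y. x \<in> B \<Longrightarrow> y \<in> B \<Longrightarrow> q (x + y) \<le> q x + q y"
    and scale: "\<And>c x. x \<in> B \<Longrightarrow> q (c *\<^sub>C x) = cmod c * q x"
    and mult: "\<And>x y. x \<in> B \<Longrightarrow> y \<in> B \<Longrightarrow> q (x * y) \<le> q x * q y"
    and cstar: "\<And>x. x \<in> B \<Longrightarrow> q (x\<^sup>\<star> * x) = (q x)\<^sup>2"
  shows "q a \<le> norm a"
proof -
  note sub = cstar_subalgebraD[OF B(1)]
  have q0: "q 0 = 0" using scale[of 0 0] sub by simp
  have qm: "q (- x) = q x" if "x \<in> B" for x
    using scale[of x "- 1"] that by (simp add: scaleC_minus_one)
  have pos: "0 \<le> q x" if "x \<in> B" for x
    using add[of x "- x"] qm[OF that] that sub(8)[OF that] q0 by simp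
  have "q 1 = (q 1)\<^sup>2" using cstar[of 1] B by simp
  then have q1: "q 1 \<le> 1" by (cases "q 1 = 0") (simp_all add: power2_eq_square)
  have sa: "q b \<le> 1" if b: "b \<in> B" "b\<^sup>\<star> = b" "norm b < 1" for b
  proof -
    have "norm (b * b) < 1"
      using norm_mult_ineq[of b b] b(3) mult_left_le[of "norm b" "norm b"] by simp
    moreover have "(b * b)\<^sup>\<star> = b * b" using b(2) by (simp add: star_mult)
    ultimately obtain w where w: "w \<in> B" "w\<^sup>\<star> = w" "w * w = 1 - b * b"
      and comm: "\<And>x. x * (b * b) = b * b * x \<Longrightarrow> x * w = w * x"
      using selfadjoint_sqrt[OF B(1,2) sub(4)[OF b(1) b(1)]] by metis
    from comm[of b] have bw: "b * w = w * b" by (simp add: mult.assoc)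
    define u where "u = b + \<i> *\<^sub>C w"
    note pair = commuting_selfadjoint_pair[OF b(2) w(2) bw, folded u_def]
    have uB: "u \<in> B" "u\<^sup>\<star> \<in> B" using b w sub by (simp_all add: u_def)
    have uu: "u\<^sup>\<star> * u = 1" "u * u\<^sup>\<star> = 1" using pair(1,2) by (simp_all add: w(3))
    have "(q u)\<^sup>2 \<le> 1\<^sup>2" "(q (u\<^sup>\<star>))\<^sup>2 \<le> 1\<^sup>2"
      using cstar[OF uB(1)] cstar[OF uB(2)] uu q1 by (simp_all add: star_star)
    then have "q u \<le> 1" "q (u\<^sup>\<star>) \<le> 1" by (simp_all add: power2_le_imp_le)
    then have "q (u + u\<^sup>\<star>) \<le> 2" using add[OF uB] by linarith
    moreover have "u + u\<^sup>\<star> = 2 *\<^sub>C b" by (rule pair(3))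
    ultimately show ?thesis using scale[OF b(1), of 2] by simp
  qed
  have le: "q b \<le> norm b" if b: "b \<in> B" "b\<^sup>\<star> = b" for b
  proof (rule dense_ge)
    fix t assume t: "norm b < t"
    then have t0: "0 < t" using norm_ge_zero le_less_trans by blast
    let ?c = "(1 / complex_of_real t) *\<^sub>C b"
    have "?c \<in> B" "?c\<^sup>\<star> = ?c" "norm ?c < 1"
      using b t t0 sub by (simp_all add: star_scaleC norm_scaleC norm_divide)
    from sa[OF this] show "q b \<le> t" using scale[OF b(1), of "1 / complex_of_real t"] t0
      by (simp add: norm_divide)
  qed
  have "(q a)\<^sup>2 \<le> (norm a)\<^sup>2"
    using le[of "a\<^sup>\<star> * a"] cstar[OF B(3)] sub(4)[OF sub(6)[OF B(3)] B(3)]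
    by (simp add: star_mult star_star norm_star_mult_self)
  then show ?thesis by (rule power2_le_imp_le) simp
qed

section \<open>Positivity\<close>

lemma inverse_commutes:
  fixes c :: "'a::monoid_mult"
  assumes "c * e = 1" "e * c = 1" "q * e = e * q"
  shows "q * c = c * q"
  by (metis assms mult.assoc mult.left_neutral mult.right_neutral)

text \<open>The norm of a self-adjoint element, up to sign, lies in its spectrum. The idea: if \<open>1 - z\<^sup>2\<close> were
  invertible, it would be bounded below, \<open>1 - z\<^sup>2 = 1/K + g\<^sup>2\<close>, and then
  \<open>\<parallel>z\<parallel>\<^sup>2 \<le> \<parallel>z\<^sup>2 + g\<^sup>2\<parallel> = 1 - 1/K < 1\<close>. To build \<open>g\<close>, let \<open>k\<close> be the inverse and
  \<open>K > \<parallel>k\<parallel>\<close>; then \<open>1 - z\<^sup>2 - 1/K = (1 - z\<^sup>2) (1 - k/K)\<close>, and both factors should have commuting square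
  roots. The first one does so only after \<open>z\<^sup>2\<close> is replaced by \<open>s z\<^sup>2\<close> with \<open>s < 1\<close> close to \<open>1\<close>.\<close>

lemma one_minus_square_not_invertible:
  fixes z :: "'a::cstar_algebra"
  assumes z: "z\<^sup>\<star> = z" "norm z = 1"
  shows "\<nexists>c. c * (1 - z * z) = 1 \<and> (1 - z * z) * c = 1"
proof safe
  fix c assume c: "c * (1 - z * z) = 1" "(1 - z * z) * c = 1"
  have U: "cstar_subalgebra (UNIV::'a set)" "(1::'a) \<in> UNIV" by (auto simp: cstar_subalgebra_def)
  define y where "y = z * z"
  have y: "y\<^sup>\<star> = y" "norm y = 1"
    using z norm_star_mult_self[of z] by (simp_all add: y_def star_mult)
  define K where "K = 2 * norm c + 1"
  \<comment> \<open>Close enough to \<open>1\<close> for \<open>1 - s y\<close> to stay invertible with inverse of norm below \<open>K\<close>, and for \<open>s > 1 - 1 / K\<close>, which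
    gives the contradiction.\<close>
  define s where "s = 1 - 1 / (2 * K)"
  have K: "1 \<le> K" "2 * norm c < K" by (auto simp: K_def)
  have s: "0 < s" "s < 1" "1 - 1 / K < s" using K by (auto simp: s_def field_simps)
  define x where "x = (- (1 - s)) *\<^sub>R (c * y)"
  have "norm x = (1 - s) * norm (c * y)" using s by (simp add: x_def)
  also have "\<dots> \<le> (1 - s) * norm c"
    using norm_mult_ineq[of c y] y s by (intro mult_left_mono) auto
  also have "\<dots> < 1 / 2" using K by (simp add: s_def field_simps)
  finally have x: "norm x < 1 / 2" .
  then have "norm x < 1" by simp
  then obtain d where d: "d * (1 - x) = 1" "(1 - x) * d = 1" "norm d * (1 - norm x) \<le> 1"
    using cstar_neumann[OF U UNIV_I] by metis
  have "norm d * (1 / 2) \<le> norm d * (1 - norm x)" using x by (intro mult_left_mono) auto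
  with d(3) have d2: "norm d \<le> 2" by linarith
  define e where "e = 1 - s *\<^sub>R y"
  define k where "k = d * c"
  have e: "e = (1 - y) * (1 - x)"
  proof -
    have "(1 - y) * x = (- (1 - s)) *\<^sub>R ((1 - y) * c * y)"
      by (simp only: x_def mult_scaleR_right mult.assoc)
    also have "\<dots> = s *\<^sub>R y - y" by (simp add: c(2)[folded y_def] scaleR_diff_left)
    finally show ?thesis by (simp add: e_def right_diff_distrib)
  qed
  have k: "k * e = 1" "e * k = 1"
    using c d by (metis e k_def mult.assoc mult.left_neutral y_def)+
  have "norm k \<le> norm d * norm c" unfolding k_def by (rule norm_mult_ineq)
  also have "\<dots> \<le> 2 * norm c" using d2 by (intro mult_right_mono) auto
  finally have nk: "norm k < K" using K by linarith
  have es: "e\<^sup>\<star> = e" using y by (simp add: e_def star_diff star_scaleR)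
  have "k\<^sup>\<star> * e = 1" "e * k\<^sup>\<star> = 1" using k es by (metis star_mult star_one)+
  then have ks: "k\<^sup>\<star> = k" using k by (metis mult.assoc mult.left_neutral mult.right_neutral)
  have "((1 / K) *\<^sub>R k)\<^sup>\<star> = (1 / K) *\<^sub>R k" "norm ((1 / K) *\<^sub>R k) < 1"
    using ks nk K by (simp_all add: star_scaleR)
  then obtain v where v: "v\<^sup>\<star> = v" "v * v = 1 - (1 / K) *\<^sub>R k"
    and vc: "\<And>q. q * ((1 / K) *\<^sub>R k) = ((1 / K) *\<^sub>R k) * q \<Longrightarrow> q * v = v * q"
    using selfadjoint_sqrt[OF U UNIV_I] by metis
  have "(s *\<^sub>R y)\<^sup>\<star> = s *\<^sub>R y" "norm (s *\<^sub>R y) < 1"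
    using y s by (simp_all add: star_scaleR)
  then obtain w where w: "w\<^sup>\<star> = w" "w * w = e"
    and wc: "\<And>q. q * (s *\<^sub>R y) = (s *\<^sub>R y) * q \<Longrightarrow> q * w = w * q"
    using selfadjoint_sqrt[OF U UNIV_I] unfolding e_def by metis
  have zw: "z * w = w * z" by (rule wc) (simp add: y_def mult.assoc)
  have "w * e = e * w" by (metis mult.assoc w(2))
  then have "w * k = k * w" by (rule inverse_commutes[OF k])
  then have wv: "w * v = v * w" by (intro vc) simp
  have "z * e = e * z" by (simp add: e_def y_def algebra_simps)
  then have "z * k = k * z" by (rule inverse_commutes[OF k])
  then have zv: "z * v = v * z" by (intro vc) simp
  define g where "g = w * v"
  have "g * g = (w * w) * (v * v)" by (metis g_def mult.assoc wv)
  also have "\<dots> = e - (1 / K) *\<^sub>R 1" by (simp add: w v right_diff_distrib k)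
  finally have gg: "g * g = e - (1 / K) *\<^sub>R 1" .
  define r where "r = sqrt s *\<^sub>R z"
  have "g\<^sup>\<star> = g" by (simp add: g_def star_mult w v wv)
  moreover have "r\<^sup>\<star> = r" by (simp add: r_def star_scaleR z)
  moreover have "r * g = g * r" by (simp add: r_def g_def) (metis mult.assoc zw zv)
  ultimately have "(norm r)\<^sup>2 \<le> norm (r * r + g * g)" by (intro norm_sq_le_norm_sum_squares)
  moreover have "r * r = s *\<^sub>R y" using s by (simp add: r_def y_def)
  then have "r * r + g * g = (1 - 1 / K) *\<^sub>R 1"
    by (simp add: gg e_def scaleR_diff_left)
  moreover have "(norm r)\<^sup>2 = s" using s z by (simp add: r_def power_mult_distrib)
  moreover have "norm ((1 - 1 / K) *\<^sub>R (1::'a)) = 1 - 1 / K" using K by simp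
  ultimately have "s \<le> 1 - 1 / K" by (simp only:)
  with s show False by simp
qed

lemma cstar_neumann_scaled:
  fixes x :: "'a::cstar_algebra"
  assumes B: "cstar_subalgebra B" "1 \<in> B" "x \<in> B" and x: "norm x < cmod m"
  obtains b where "b \<in> B" "b * (m *\<^sub>C 1 - x) = 1" "(m *\<^sub>C 1 - x) * b = 1"
proof -
  note sub = cstar_subalgebraD[OF B(1)]
  have m: "m \<noteq> 0" using x by auto
  have "norm ((1 / m) *\<^sub>C x) < 1" using x m by (simp add: norm_scaleC norm_divide)
  then obtain b where b: "b \<in> B" "b * (1 - (1 / m) *\<^sub>C x) = 1" "(1 - (1 / m) *\<^sub>C x) * b = 1"
    using cstar_neumann[OF B(1,2) sub(5)[OF B(3)]] by metis
  have "m *\<^sub>C 1 - x = m *\<^sub>C (1 - (1 / m) *\<^sub>C x)" using m by (simp add: scaleC_diff scaleC_scaleC)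
  then have "((1 / m) *\<^sub>C b) * (m *\<^sub>C 1 - x) = 1" "(m *\<^sub>C 1 - x) * ((1 / m) *\<^sub>C b) = 1"
    using b m by (simp_all add: mult_scaleC_left mult_scaleC_right scaleC_scaleC)
  with sub(5)[OF b(1)] show ?thesis using that by blast
qed

text \<open>Otherwise \<open>x = t - a\<close> is self-adjoint with \<open>R = \<parallel>x\<parallel> > t\<close>. Now \<open>R - x = a + (R - t)\<close> is invertible since \<open>a\<close>
  is positive, and \<open>R + x = (R + t) - a\<close> is invertible since \<open>R + t > \<parallel>a\<parallel>\<close>. So \<open>R\<^sup>2 - x\<^sup>2\<close> is invertible, contrary
  to the preceding non-invertibility applied to \<open>x / R\<close>.\<close>

lemma positive_in_norm:
  fixes a :: "'a::cstar_algebra"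
  assumes a: "positive_in B a" and t: "norm a \<le> t"
  shows "norm (t *\<^sub>R 1 - a) \<le> t"
proof (rule ccontr)
  have U: "cstar_subalgebra (UNIV::'a set)" "(1::'a) \<in> UNIV" by (auto simp: cstar_subalgebra_def)
  define x where "x = t *\<^sub>R 1 - a"
  define R where "R = norm x"
  assume "\<not> norm (t *\<^sub>R 1 - a) \<le> t"
  then have R: "t < R" by (simp add: R_def x_def)
  have t0: "0 \<le> t" using t norm_ge_zero order.trans by blast
  have "complex_of_real (t - R) \<notin> spectrum_in B a"
    using a R unfolding positive_in_def by (auto simp: image_iff simp del: of_real_diff)
  then obtain b where b: "b * (complex_of_real (t - R) *\<^sub>C 1 - a) = 1"
    "(complex_of_real (t - R) *\<^sub>C 1 - a) * b = 1"
    unfolding spectrum_in_def by blast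
  have "complex_of_real (t - R) *\<^sub>C 1 - a = - (R *\<^sub>R 1 - x)"
    unfolding scaleR_scaleC[symmetric] by (simp add: x_def scaleR_diff_left)
  with b have b': "(- b) * (R *\<^sub>R 1 - x) = 1" "(R *\<^sub>R 1 - x) * (- b) = 1"
    by (metis minus_mult_commute)+
  have "norm a < cmod (complex_of_real (R + t))"
    unfolding norm_of_real using t R t0 by linarith
  then obtain d where d: "d * (complex_of_real (R + t) *\<^sub>C 1 - a) = 1"
    "(complex_of_real (R + t) *\<^sub>C 1 - a) * d = 1"
    using cstar_neumann_scaled[OF U UNIV_I] by metis
  have "complex_of_real (R + t) *\<^sub>C 1 - a = R *\<^sub>R 1 + x"
    unfolding scaleR_scaleC[symmetric] by (simp add: x_def scaleR_add_left)
  with d have d': "d * (R *\<^sub>R 1 + x) = 1" "(R *\<^sub>R 1 + x) * d = 1" by simp_all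
  define z where "z = (1 / R) *\<^sub>R x"
  have R0: "0 < R" using R t0 by simp
  have "(R *\<^sub>R 1 - x) * (R *\<^sub>R 1 + x) = R\<^sup>2 *\<^sub>R (1 - z * z)"
    using R0 by (simp add: z_def algebra_simps power2_eq_square)
  moreover have "(d * - b) * ((R *\<^sub>R 1 - x) * (R *\<^sub>R 1 + x)) = 1"
    "((R *\<^sub>R 1 - x) * (R *\<^sub>R 1 + x)) * (d * - b) = 1"
    using b' d' by (metis mult.assoc mult.left_neutral)+
  ultimately have "(R\<^sup>2 *\<^sub>R (d * - b)) * (1 - z * z) = 1" "(1 - z * z) * (R\<^sup>2 *\<^sub>R (d * - b)) = 1"
    by (simp_all only: mult_scaleR_left mult_scaleR_right)
  moreover have "z\<^sup>\<star> = z" "norm z = 1"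
    using a R0 by (simp_all add: z_def x_def star_scaleR star_diff positive_in_def R_def)
  ultimately show False using one_minus_square_not_invertible by blast
qed

text \<open>The converse. All inverses are Neumann series, hence lie in \<open>B\<close>. A negative \<open>l\<close> is
  farther from \<open>t\<close> than \<open>\<parallel>t - a\<parallel>\<close>. A non-real \<open>l\<close> becomes large compared with \<open>a\<close> when both are shifted by
  \<open>\<i> s\<close>: \<open>\<parallel>a + \<i> s\<parallel>\<^sup>2 \<le> \<parallel>a\<parallel>\<^sup>2 + s\<^sup>2\<close>, while \<open>\<bar>l + \<i> s\<bar>\<^sup>2\<close> also contains the term \<open>2 s Im l\<close>.\<close>

lemma positive_in_of_norm:
  fixes a :: "'a::cstar_algebra"
  assumes B: "cstar_subalgebra B" "1 \<in> B" "a \<in> B" and a: "a\<^sup>\<star> = a" "norm (t *\<^sub>R 1 - a) \<le> t"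
  shows "positive_in B a"
  unfolding positive_in_def
proof (intro conjI subsetI B a)
  note sub = cstar_subalgebraD[OF B(1)]
  fix l assume l: "l \<in> spectrum_in B a"
  have noninv: False if "b \<in> B" "b * (l *\<^sub>C 1 - a) = 1" "(l *\<^sub>C 1 - a) * b = 1" for b
    using l that unfolding spectrum_in_def by blast
  have real: "Im l = 0"
  proof (rule ccontr)
    assume Im: "Im l \<noteq> 0"
    \<comment> \<open>Chosen so that \<open>2 s Im l = \<parallel>a\<parallel>\<^sup>2\<close>.\<close>
    define s where "s = (norm a)\<^sup>2 / (2 * Im l)"
    define x where "x = a + s *\<^sub>R (\<i> *\<^sub>C 1)"
    have "x = a + (of_real s * \<i>) *\<^sub>C 1" by (simp add: x_def scaleR_scaleC scaleC_scaleC)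
    moreover have "(of_real s * \<i>) *\<^sub>C 1 = \<i> *\<^sub>C (s *\<^sub>R (1::'a))"
      by (simp add: scaleR_scaleC scaleC_scaleC mult.commute)
    ultimately have x2: "x = a + \<i> *\<^sub>C (s *\<^sub>R 1)" by simp
    have "x\<^sup>\<star> * x = a * a + (s *\<^sub>R 1) * (s *\<^sub>R 1)"
      unfolding x2 by (rule commuting_selfadjoint_pair(1)) (use a in \<open>auto simp: star_scaleR\<close>)
    then have "(norm x)\<^sup>2 = norm (a * a + s\<^sup>2 *\<^sub>R 1)"
      using norm_star_mult_self[of x] by (simp add: power2_eq_square)
    also have "\<dots> \<le> norm (a * a) + norm (s\<^sup>2 *\<^sub>R (1::'a))" by (rule norm_triangle_ineq)
    also have "norm (a * a) = (norm a)\<^sup>2" using norm_star_mult_self[of a] a by simp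
    also have "norm (s\<^sup>2 *\<^sub>R (1::'a)) = s\<^sup>2" by simp
    also have "(norm a)\<^sup>2 = 2 * Im l * s" using Im by (simp add: s_def)
    also have "2 * Im l * s + s\<^sup>2 < (Im l + s)\<^sup>2 + (Re l)\<^sup>2"
      using Im by (simp add: power2_sum sum_power2_gt_zero_iff add_pos_nonneg)
    also have "\<dots> = (cmod (l + of_real s * \<i>))\<^sup>2" by (simp add: cmod_def)
    finally have "norm x < cmod (l + of_real s * \<i>)" by (rule power2_less_imp_less) simp
    moreover have "x \<in> B" using B sub by (simp add: x_def)
    ultimately obtain b where "b \<in> B" "b * ((l + of_real s * \<i>) *\<^sub>C 1 - x) = 1"
      "((l + of_real s * \<i>) *\<^sub>C 1 - x) * b = 1"
      using cstar_neumann_scaled[OF B(1,2)] by metis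
    moreover have "(l + of_real s * \<i>) *\<^sub>C 1 - x = l *\<^sub>C 1 - a"
      by (simp add: x_def scaleC_add_left scaleR_scaleC scaleC_scaleC)
    ultimately show False using noninv by metis
  qed
  then have lr: "l = complex_of_real (Re l)" by (simp add: complex_eq_iff)
  have "0 \<le> Re l"
  proof (rule ccontr)
    assume neg: "\<not> 0 \<le> Re l"
    have t0: "0 \<le> t" using a(2) norm_ge_zero order.trans by blast
    have "norm (a - t *\<^sub>R 1) < cmod (complex_of_real (Re l - t))"
      using a(2) neg t0 by (simp add: norm_minus_commute del: of_real_diff)
    moreover have "a - t *\<^sub>R 1 \<in> B" using B sub by simp
    ultimately obtain b where b: "b \<in> B" "b * (complex_of_real (Re l - t) *\<^sub>C 1 - (a - t *\<^sub>R 1)) = 1"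
      "(complex_of_real (Re l - t) *\<^sub>C 1 - (a - t *\<^sub>R 1)) * b = 1"
      using cstar_neumann_scaled[OF B(1,2)] by metis
    have "complex_of_real (Re l - t) *\<^sub>C 1 - (a - t *\<^sub>R 1) = complex_of_real (Re l) *\<^sub>C 1 - a"
      unfolding scaleR_scaleC[symmetric] by (simp add: scaleR_diff_left)
    with b lr noninv show False by metis
  qed
  with lr show "l \<in> complex_of_real ` {0..}" by (metis atLeast_iff image_eqI)
qed

text \<open>By the two preceding lemmas positivity of \<open>a\<close> is the norm inequality \<open>\<parallel>t - a\<parallel> \<le> t\<close> with \<open>t = \<parallel>a\<parallel>\<close>, and a compression by an
  isometry maps \<open>t - a\<close> to \<open>t - V\<^sup>\<star> a V\<close> without increasing norms.\<close>

lemma positive_in_conjugate: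
  fixes V a :: "'a::cstar_algebra"
  assumes B: "cstar_subalgebra B" "1 \<in> B" and V: "V\<^sup>\<star> * V = 1"
    and a: "positive_in B a" and VaV: "V\<^sup>\<star> * a * V \<in> B"
  shows "positive_in B (V\<^sup>\<star> * a * V)"
proof (rule positive_in_of_norm[OF B VaV])
  have as: "a\<^sup>\<star> = a" using a by (simp add: positive_in_def)
  then show "(V\<^sup>\<star> * a * V)\<^sup>\<star> = V\<^sup>\<star> * a * V" by (simp add: star_mult star_star mult.assoc)
  have "(norm V)\<^sup>2 = 1" using norm_star_mult_self[of V] V by simp
  then have nV: "norm V = 1" by (simp add: power2_eq_1_iff) (smt (verit) norm_ge_zero)
  define x where "x = norm a *\<^sub>R 1 - a"
  have "norm a *\<^sub>R 1 - V\<^sup>\<star> * a * V = V\<^sup>\<star> * x * V"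
    using V by (simp add: x_def algebra_simps)
  also have "norm \<dots> \<le> norm (V\<^sup>\<star> * x) * norm V" by (rule norm_mult_ineq)
  also have "\<dots> \<le> norm x" using norm_mult_ineq[of "V\<^sup>\<star>" x] nV by simp
  also have "\<dots> \<le> norm a" unfolding x_def by (rule positive_in_norm[OF a order.refl])
  finally show "norm (norm a *\<^sub>R 1 - V\<^sup>\<star> * a * V) \<le> norm a" .
qed

text \<open>The difference \<open>d = b - s\<close> satisfies \<open>d (b + s) + (b + s) d = 2 (b\<^sup>2 - s\<^sup>2) = 0\<close>. With \<open>x = T - (b + s)\<close>
  this reads \<open>2 T d = d x + x d\<close>, and positivity gives \<open>\<parallel>x\<parallel> \<le> T - \<epsilon>\<close> for large \<open>T\<close>, which forces \<open>d = 0\<close>.\<close>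

lemma positive_sqrt_unique:
  fixes b s :: "'a::cstar_algebra"
  assumes b: "positive_in B b" and s: "positive_in B (s - \<epsilon> *\<^sub>R 1)" and \<epsilon>: "0 < \<epsilon>"
    and eq: "b * b = s * s"
  shows "b = s"
proof -
  define t where "t = norm (s - \<epsilon> *\<^sub>R 1)"
  define T where "T = norm b + t + \<epsilon>"
  define x where "x = T *\<^sub>R 1 - (b + s)"
  have "x = (norm b *\<^sub>R 1 - b) + (t *\<^sub>R 1 - (s - \<epsilon> *\<^sub>R 1))"
    by (simp add: x_def T_def scaleR_add_left)
  also have "norm \<dots> \<le> norm b + t"
    using positive_in_norm[OF b order.refl] positive_in_norm[OF s order.refl]
    by (intro norm_triangle_mono) (simp_all add: t_def)
  finally have x: "norm x \<le> T - \<epsilon>" by (simp add: T_def)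
  have "(2 * T) *\<^sub>R (b - s) = (b - s) * x + x * (b - s)"
  proof -
    have "(b - s) * (b + s) + (b + s) * (b - s) = 0" using eq by (simp add: algebra_simps)
    moreover have "(2 * T) *\<^sub>R (b - s) = T *\<^sub>R (b - s) + T *\<^sub>R (b - s)"
      by (simp only: mult_2 scaleR_add_left)
    moreover have "(b - s) * x = T *\<^sub>R (b - s) - (b - s) * (b + s)"
      "x * (b - s) = T *\<^sub>R (b - s) - (b + s) * (b - s)"
      unfolding x_def by (simp_all only: right_diff_distrib[of "b - s"] left_diff_distrib[of _ _ "b - s"]
          mult_scaleR_left mult_scaleR_right mult_1_left mult_1_right)
    ultimately show ?thesis by (metis add_diff_add diff_zero)
  qed
  then have "norm ((2 * T) *\<^sub>R (b - s)) \<le> norm (b - s) * norm x + norm x * norm (b - s)"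
    by (metis norm_mult_ineq norm_triangle_mono)
  moreover have "0 \<le> T" using \<epsilon> by (simp add: T_def t_def)
  ultimately have "T * norm (b - s) \<le> norm x * norm (b - s)" by (simp add: mult.commute)
  also have "\<dots> \<le> (T - \<epsilon>) * norm (b - s)" using x by (rule mult_right_mono) simp
  finally have "\<epsilon> * norm (b - s) \<le> 0" by (simp add: algebra_simps)
  with \<epsilon> show ?thesis by (simp add: mult_le_0_iff)
qed

section \<open>Substitution in free *-algebras\<close>

lemma word_star_star [simp]: "word_star (word_star w) = w"
  by (cases w) (simp add: word_star_def rev_map comp_def case_prod_beta)

lemma word_star_plus: "word_star (v + w) = word_star w + word_star v"
  by (simp add: word_star_def plus_star_word_def)

lemma word_star_zero [simp]: "word_star 0 = 0"
  by (simp add: word_star_def zero_star_word_def)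

lemma free_star_superset:
  assumes "finite K" "Poly_Mapping.keys x \<subseteq> K"
  shows "free_star x = (\<Sum>w\<in>K. Poly_Mapping.single (word_star w) (cnj (Poly_Mapping.lookup x w)))"
  unfolding free_star_def using assms
  by (intro sum.mono_neutral_left) (auto simp: in_keys_iff)

lemma free_star_single [simp]:
  "free_star (Poly_Mapping.single w c) = Poly_Mapping.single (word_star w) (cnj c)"
  by (subst free_star_superset[of "{w}"]) auto

lemma free_star_zero [simp]: "free_star 0 = 0"
  by (simp add: free_star_def)

lemma free_star_add [simp]: "free_star (x + y) = free_star x + free_star y"
proof -
  let ?K = "Poly_Mapping.keys x \<union> Poly_Mapping.keys y"
  have "Poly_Mapping.keys (x + y) \<subseteq> ?K" by (rule Poly_Mapping.keys_add)
  then show ?thesis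
    by (subst (1 2 3) free_star_superset[of ?K]) (auto simp: lookup_add single_add sum.distrib)
qed

lemma free_star_diff [simp]: "free_star (x - y) = free_star x - free_star y"
  by (metis add_diff_cancel diff_add_cancel free_star_add)

lemma free_star_mult [simp]: "free_star (x * y) = free_star y * free_star x"
proof (induction x rule: free_induct)
  case (single v c)
  show ?case
    by (induction y rule: free_induct)
      (auto simp: mult_single word_star_plus distrib_left distrib_right mult.commute)
qed (auto simp: distrib_left distrib_right)

lemma free_star_star [simp]: "free_star (free_star x) = x"
  by (induction x rule: free_induct) auto

lemma free_star_one [simp]: "free_star 1 = 1"
  by (simp flip: single_one)

lemma free_scale_single: "free_scale c (Poly_Mapping.single w d) = Poly_Mapping.single w (c * d)"
  by (simp add: free_scale_def mult_single)

lemma free_scale_add_right: "free_scale c (x + y) = free_scale c x + free_scale c y"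
  by (simp add: free_scale_def distrib_left)

lemma free_scale_add_left: "free_scale (c + d) x = free_scale c x + free_scale d x"
  by (simp add: free_scale_def single_add distrib_right)

lemma free_scale_scale: "free_scale c (free_scale d x) = free_scale (c * d) x"
  by (simp add: free_scale_def mult_single flip: mult.assoc)

lemma free_scale_one [simp]: "free_scale 1 x = x"
  by (simp add: free_scale_def)

lemma free_scale_zero_right [simp]: "free_scale c 0 = 0"
  by (simp add: free_scale_def)

lemma free_scale_zero_left [simp]: "free_scale 0 x = 0"
  by (simp add: free_scale_def)

lemma free_scale_diff_right: "free_scale c (x - y) = free_scale c x - free_scale c y"
  by (simp add: free_scale_def right_diff_distrib)

lemma free_scale_minus_one: "free_scale (- 1) x = - x"
proof -
  have "free_scale (- 1) x + free_scale 1 x = 0"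
    unfolding free_scale_add_left[symmetric] by simp
  then show ?thesis by (simp add: eq_neg_iff_add_eq_0)
qed

lemma free_scale_mult_left: "free_scale c x * y = free_scale c (x * y)"
  by (simp add: free_scale_def mult.assoc)

lemma free_scale_mult_right: "x * free_scale c y = free_scale c (x * y)"
proof -
  have "x * Poly_Mapping.single 0 c = Poly_Mapping.single 0 c * x"
    by (induction x rule: free_induct) (auto simp: mult_single distrib_left distrib_right mult.commute)
  then show ?thesis by (simp add: free_scale_def flip: mult.assoc)
qed

lemma free_star_scale [simp]: "free_star (free_scale c x) = free_scale (cnj c) (free_star x)"
  by (induction x rule: free_induct) (auto simp: free_scale_single free_scale_add_right)

text \<open>Substitution: the *-homomorphism between free *-algebras that sends each letter \<open>x\<close> to
  \<open>h x\<close>. It plays the role of \<open>eval_free\<close> with values in another free *-algebra.\<close>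

definition subst_word :: "('g \<Rightarrow> 'h free_star_alg) \<Rightarrow> 'g star_word \<Rightarrow> 'h free_star_alg" where
  "subst_word h w = prod_list (map (\<lambda>(x, s). if s then free_star (h x) else h x) (letters w))"

definition free_subst :: "('g \<Rightarrow> 'h free_star_alg) \<Rightarrow> 'g free_star_alg \<Rightarrow> 'h free_star_alg" where
  "free_subst h x = (\<Sum>w\<in>Poly_Mapping.keys x. free_scale (Poly_Mapping.lookup x w) (subst_word h w))"

lemma free_subst_superset:
  assumes "finite K" "Poly_Mapping.keys x \<subseteq> K"
  shows "free_subst h x = (\<Sum>w\<in>K. free_scale (Poly_Mapping.lookup x w) (subst_word h w))"
  unfolding free_subst_def using assms
  by (intro sum.mono_neutral_left) (auto simp: in_keys_iff)

lemma free_subst_single [simp]: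
  "free_subst h (Poly_Mapping.single w c) = free_scale c (subst_word h w)"
  by (subst free_subst_superset[of "{w}"]) auto

lemma free_subst_zero [simp]: "free_subst h 0 = 0"
  by (simp add: free_subst_def)

lemma free_subst_add [simp]: "free_subst h (x + y) = free_subst h x + free_subst h y"
proof -
  let ?K = "Poly_Mapping.keys x \<union> Poly_Mapping.keys y"
  have "Poly_Mapping.keys (x + y) \<subseteq> ?K" by (rule Poly_Mapping.keys_add)
  then show ?thesis
    by (subst (1 2 3) free_subst_superset[of ?K])
      (auto simp: lookup_add free_scale_add_left sum.distrib)
qed

lemma free_subst_diff [simp]: "free_subst h (x - y) = free_subst h x - free_subst h y"
  by (metis add_diff_cancel diff_add_cancel free_subst_add)

lemma free_subst_sum [simp]: "free_subst h (\<Sum>i\<in>I. f i) = (\<Sum>i\<in>I. free_subst h (f i))"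
  by (induction I rule: infinite_finite_induct) auto

lemma subst_word_plus: "subst_word h (v + w) = subst_word h v * subst_word h w"
  by (simp add: subst_word_def plus_star_word_def)

lemma subst_word_zero [simp]: "subst_word h 0 = 1"
  by (simp add: subst_word_def zero_star_word_def)

lemma subst_word_star: "subst_word h (word_star w) = free_star (subst_word h w)"
proof -
  have "prod_list (map (\<lambda>(x, s). if s then free_star (h x) else h x) (rev (map (\<lambda>(x, s). (x, \<not> s)) l))) =
    free_star (prod_list (map (\<lambda>(x, s). if s then free_star (h x) else h x) l))" for l
    by (induction l) auto
  then show ?thesis by (simp add: subst_word_def word_star_def)
qed

lemma free_subst_one [simp]: "free_subst h 1 = 1"
  by (simp flip: single_one)

lemma free_subst_mult [simp]: "free_subst h (x * y) = free_subst h x * free_subst h y"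
proof (induction x rule: free_induct)
  case (single v c)
  show ?case
    by (induction y rule: free_induct)
      (auto simp: mult_single subst_word_plus free_scale_mult_left free_scale_mult_right
        free_scale_scale distrib_left mult.commute)
qed (auto simp: distrib_right)

lemma free_subst_scale [simp]: "free_subst h (free_scale c x) = free_scale c (free_subst h x)"
  by (induction x rule: free_induct)
    (auto simp: free_scale_single free_scale_add_right free_scale_scale)

lemma free_subst_star [simp]: "free_subst h (free_star x) = free_star (free_subst h x)"
  by (induction x rule: free_induct) (auto simp: subst_word_star)

lemma free_subst_gen [simp]: "free_subst h (gen x) = h x"
  by (simp add: gen_def subst_word_def)

lemma free_subst_of_nat [simp]: "free_subst h (of_nat k) = of_nat k"
  by (induction k) auto

lemma eval_free_subst: "eval_free g (free_subst h x) = eval_free (\<lambda>i. eval_free g (h i)) x"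
proof -
  have "eval_free g (prod_list (map (\<lambda>(x, s). if s then free_star (h x) else h x) l)) =
    prod_list (map (\<lambda>(x, s). if s then (eval_free g (h x))\<^sup>\<star> else eval_free g (h x)) l)" for l
    by (induction l) auto
  then have "eval_free g (subst_word h w) = eval_word (\<lambda>i. eval_free g (h i)) w" for w
    by (simp add: subst_word_def eval_word_def)
  then show ?thesis by (induction x rule: free_induct) auto
qed

lemma eval_free_cong_on:
  assumes "x \<in> free_on G" "\<And>i. i \<in> G \<Longrightarrow> g i = h i"
  shows "eval_free g x = eval_free h x"
  unfolding eval_free_def
proof (rule sum.cong[OF refl])
  fix w assume "w \<in> Poly_Mapping.keys x"
  then have "fst ` set (letters w) \<subseteq> G" using assms(1) by (simp add: free_on_def)
  then have "map (\<lambda>(x, s). if s then (g x)\<^sup>\<star> else g x) (letters w) =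
      map (\<lambda>(x, s). if s then (h x)\<^sup>\<star> else h x) (letters w)"
    using assms(2) by (intro map_cong) auto
  then show "Poly_Mapping.lookup x w *\<^sub>C eval_word g w = Poly_Mapping.lookup x w *\<^sub>C eval_word h w"
    unfolding eval_word_def by (simp only:)
qed

text \<open>Induction principle: \<open>free_on G\<close> is the unital *-algebra generated by the letters in \<open>G\<close>.\<close>

lemma free_on_minimal:
  assumes "x \<in> free_on G" and gen: "\<And>i. i \<in> G \<Longrightarrow> P (gen i)" and one: "P 1" "P 0"
    and add: "\<And>x y. P x \<Longrightarrow> P y \<Longrightarrow> P (x + y)" and mult: "\<And>x y. P x \<Longrightarrow> P y \<Longrightarrow> P (x * y)"
    and scale: "\<And>c x. P x \<Longrightarrow> P (free_scale c x)" and star: "\<And>x. P x \<Longrightarrow> P (free_star x)"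
  shows "P x"
proof -
  have word: "P (Poly_Mapping.single (Word l) 1)" if "fst ` set l \<subseteq> G" for l
    using that
  proof (induction l)
    case Nil
    show ?case using one by (simp flip: zero_star_word_def)
  next
    case (Cons a l)
    obtain i s where a: "a = (i, s)" by force
    have "P (gen i)" using Cons a gen by auto
    then have "P (if s then free_star (gen i) else gen i)" using star by auto
    moreover have "Poly_Mapping.single (Word (a # l)) 1 =
        (if s then free_star (gen i) else gen i) * Poly_Mapping.single (Word l) 1"
      by (auto simp: a gen_def mult_single plus_star_word_def word_star_def)
    ultimately show ?case using Cons mult by auto
  qed
  have "P (\<Sum>w\<in>K. Poly_Mapping.single w (Poly_Mapping.lookup x w))"
    if "finite K" "K \<subseteq> Poly_Mapping.keys x" for K
    using that
  proof (induction K)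
    case (insert w K)
    then have "fst ` set (letters w) \<subseteq> G" using assms(1) by (auto simp: free_on_def)
    then have "P (free_scale (Poly_Mapping.lookup x w) (Poly_Mapping.single w 1))"
      using scale word[of "letters w"] by simp
    with insert add show ?case by (simp add: free_scale_single)
  qed (simp add: one)
  then show ?thesis using free_as_sum[of x] by (metis finite_keys order.refl)
qed

section \<open>C*-seminorms on free *-algebras\<close>

locale free_cstar_seminorm =
  fixes p :: "'g free_star_alg \<Rightarrow> real"
  assumes cstar_seminorm: "cstar_seminorm p"
begin

lemma p_add: "p (x + y) \<le> p x + p y"
  and p_scale: "p (free_scale c x) = cmod c * p x"
  and p_mult: "p (x * y) \<le> p x * p y"
  and p_cstar: "p (free_star x * x) = (p x)\<^sup>2"
  using cstar_seminorm by (auto simp: cstar_seminorm_def)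

lemma p_zero [simp]: "p 0 = 0"
  using p_scale[of 0 0] by simp

lemma p_minus [simp]: "p (- x) = p x"
  using p_scale[of "- 1" x] by (simp add: free_scale_minus_one)

lemma p_nonneg [simp]: "0 \<le> p x"
  using p_add[of x "- x"] by simp

lemma p_diff: "p (x - y) \<le> p x + p y"
  using p_add[of x "- y"] by simp

lemma p_star [simp]: "p (free_star x) = p x"
proof -
  have le: "p x \<le> p (free_star x)" for x
  proof (cases "p x = 0")
    case False
    have "p x * p x \<le> p (free_star x) * p x"
      using p_mult[of "free_star x" x] p_cstar[of x] by (simp add: power2_eq_square)
    moreover have "0 < p x" using False p_nonneg[of x] by linarith
    ultimately show ?thesis by simp
  qed simp
  from le[of x] le[of "free_star x"] show ?thesis by simp
qed

text \<open>Congruence modulo the kernel of \<open>p\<close>, a *-ideal. Identities that hold in the C*-algebra defined by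
  \<open>p\<close> are calculated with this relation on representatives in the free *-algebra.\<close>

definition eqv :: "'g free_star_alg \<Rightarrow> 'g free_star_alg \<Rightarrow> bool" (infix "\<doteq>" 50) where
  "x \<doteq> y \<longleftrightarrow> p (x - y) = 0"

lemma eqv_refl [simp, intro]: "x \<doteq> x"
  by (simp add: eqv_def)

lemma eqv_sym: "x \<doteq> y \<Longrightarrow> y \<doteq> x"
  unfolding eqv_def by (metis p_minus minus_diff_eq)

lemma eqv_trans [trans]: "x \<doteq> y \<Longrightarrow> y \<doteq> z \<Longrightarrow> x \<doteq> z"
  unfolding eqv_def using p_add[of "x - y" "y - z"] p_nonneg[of "x - z"] by simp

lemma eq_eqv_trans [trans]: "x = y \<Longrightarrow> y \<doteq> z \<Longrightarrow> x \<doteq> z"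
  and eqv_eq_trans [trans]: "x \<doteq> y \<Longrightarrow> y = z \<Longrightarrow> x \<doteq> z"
  by simp_all

lemma eqv_add: "x \<doteq> x' \<Longrightarrow> y \<doteq> y' \<Longrightarrow> x + y \<doteq> x' + y'"
  unfolding eqv_def using p_add[of "x - x'" "y - y'"] p_nonneg[of "x + y - (x' + y')"]
  by (simp add: add_diff_add antisym)

lemma eqv_mult:
  assumes "x \<doteq> x'" "y \<doteq> y'"
  shows "x * y \<doteq> x' * y'"
proof -
  have "p (x * y - x' * y') = p ((x - x') * y + x' * (y - y'))" by (simp add: algebra_simps)
  also have "\<dots> \<le> p (x - x') * p y + p x' * p (y - y')"
    by (intro order.trans[OF p_add] add_mono p_mult)
  also have "\<dots> = 0" using assms by (simp add: eqv_def)
  finally show ?thesis unfolding eqv_def using p_nonneg by (metis order.antisym)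
qed

lemma eqv_scale: "x \<doteq> y \<Longrightarrow> free_scale c x \<doteq> free_scale c y"
  unfolding eqv_def by (simp add: p_scale flip: free_scale_diff_right)

lemma eqv_sum: "(\<And>i. i \<in> I \<Longrightarrow> f i \<doteq> g i) \<Longrightarrow> (\<Sum>i\<in>I. f i) \<doteq> (\<Sum>i\<in>I. g i)"
  by (induction I rule: infinite_finite_induct) (auto intro: eqv_add)

lemma eqv_p: "x \<doteq> y \<Longrightarrow> p x = p y"
  unfolding eqv_def using p_add[of "x - y" y] p_add[of "y - x" x] p_minus[of "x - y"] by simp

lemma cstar_seminorm_subst: "cstar_seminorm (\<lambda>x. p (free_subst h x))"
  using p_add p_scale p_mult p_cstar by (simp add: cstar_seminorm_def)

end

lemma cstar_seminorm_max:
  assumes "cstar_seminorm p" "cstar_seminorm q"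
  shows "cstar_seminorm (\<lambda>x. max (p x) (q x))"
proof -
  interpret p: free_cstar_seminorm p by standard (rule assms)
  interpret q: free_cstar_seminorm q by standard (rule assms)
  have "max (p (x + y)) (q (x + y)) \<le> max (p x) (q x) + max (p y) (q y)" for x y
    using p.p_add[of x y] q.p_add[of x y] by linarith
  moreover have "max (p (free_scale c x)) (q (free_scale c x)) = cmod c * max (p x) (q x)" for c x
    by (simp add: p.p_scale q.p_scale max_mult_distrib_left)
  moreover have "max (p (x * y)) (q (x * y)) \<le> max (p x) (q x) * max (p y) (q y)" for x y
  proof (rule max.boundedI)
    show "p (x * y) \<le> max (p x) (q x) * max (p y) (q y)"
      by (rule order.trans[OF p.p_mult]) (auto intro!: mult_mono simp: le_max_iff_disj)
    show "q (x * y) \<le> max (p x) (q x) * max (p y) (q y)"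
      by (rule order.trans[OF q.p_mult]) (auto intro!: mult_mono simp: le_max_iff_disj)
  qed
  moreover have "max (p (free_star x * x)) (q (free_star x * x)) = (max (p x) (q x))\<^sup>2" for x
    unfolding p.p_cstar q.p_cstar max_def by (auto simp: power2_le_iff_abs_le intro: antisym)
  ultimately show ?thesis by (simp add: cstar_seminorm_def)
qed

section \<open>Cuntz--Krieger families\<close>

lemma sum_sandwich:
  fixes f g :: "_ \<Rightarrow> 'a::semiring_0"
  shows "(\<Sum>j\<in>I. f j) * a * (\<Sum>k\<in>J. g k) = (\<Sum>j\<in>I. \<Sum>k\<in>J. f j * a * g k)"
  unfolding sum_distrib_right unfolding sum_distrib_left ..

text \<open>A family satisfying the Cuntz--Krieger relations, universal or not.\<close>

locale ck_family =
  fixes n :: nat and A :: "nat \<Rightarrow> nat \<Rightarrow> nat" and S :: "nat \<Rightarrow> 'a::cstar_algebra"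
  assumes A_01: "i \<in> {1..n} \<Longrightarrow> j \<in> {1..n} \<Longrightarrow> A i j \<in> {0, 1}"
    and A_column: "j \<in> {1..n} \<Longrightarrow> \<exists>i\<in>{1..n}. A i j \<noteq> 0"
    and S_piso: "i \<in> {1..n} \<Longrightarrow> S i * (S i)\<^sup>\<star> * S i = S i"
    and P_orth: "i \<in> {1..n} \<Longrightarrow> j \<in> {1..n} \<Longrightarrow> i \<noteq> j \<Longrightarrow> ck_P S i * ck_P S j = 0"
    and Q_eq: "i \<in> {1..n} \<Longrightarrow> (S i)\<^sup>\<star> * S i = (\<Sum>r=1..n. of_nat (A i r) * ck_P S r)"
    and P_sum: "(\<Sum>i=1..n. ck_P S i) = 1"
begin

(* Sums and membership assumptions are to keep the common form {1..n}. *)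
declare One_nat_def [simp del]

abbreviation P :: "nat \<Rightarrow> 'a" where "P \<equiv> ck_P S"
abbreviation E :: "nat \<Rightarrow> 'a" where "E \<equiv> ck_alpha_P n S"
abbreviation F :: "'a set" where "F \<equiv> ck_core n S"
abbreviation V :: 'a where "V \<equiv> ck_isometry n A S"

lemma P_star [simp]: "(P i)\<^sup>\<star> = P i"
  by (simp add: ck_P_def star_mult star_star)

lemma P_S:
  assumes "i \<in> {1..n}" "j \<in> {1..n}"
  shows "P i * S j = (if i = j then S j else 0)"
proof (cases "i = j")
  case False
  have "P i * S j = P i * P j * S j" using S_piso[OF assms(2)] by (simp add: ck_P_def mult.assoc)
  with P_orth[OF assms False] False show ?thesis by simp
qed (use S_piso[OF assms(2)] in \<open>simp add: ck_P_def\<close>)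

lemma P_mult: "i \<in> {1..n} \<Longrightarrow> j \<in> {1..n} \<Longrightarrow> P i * P j = (if i = j then P i else 0)"
  using P_S[of i j] unfolding ck_P_def[of S j] by (simp add: ck_P_def flip: mult.assoc)

lemma S_star_P: "i \<in> {1..n} \<Longrightarrow> j \<in> {1..n} \<Longrightarrow> (S i)\<^sup>\<star> * P j = (if i = j then (S i)\<^sup>\<star> else 0)"
  using arg_cong[OF P_S[of j i], of star] by (auto simp: star_mult)

lemma S_star_S: "i \<in> {1..n} \<Longrightarrow> j \<in> {1..n} \<Longrightarrow> i \<noteq> j \<Longrightarrow> (S i)\<^sup>\<star> * S j = 0"
  by (metis P_S S_star_P mult.assoc mult_zero_right)

lemma P_Q:
  assumes "r \<in> {1..n}" "j \<in> {1..n}"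
  shows "P r * ((S j)\<^sup>\<star> * S j) = of_nat (A j r) *\<^sub>C P r"
proof -
  have "P r * ((S j)\<^sup>\<star> * S j) = (\<Sum>t=1..n. if t = r then of_nat (A j r) *\<^sub>C P r else 0)"
    unfolding Q_eq[OF assms(2)] sum_distrib_left scaleC_of_nat mult_scaleC_right
    by (rule sum.cong) (use assms in \<open>auto simp: P_mult\<close>)
  then show ?thesis using assms by simp
qed

lemma Q_P:
  assumes "r \<in> {1..n}" "j \<in> {1..n}"
  shows "(S j)\<^sup>\<star> * S j * P r = of_nat (A j r) *\<^sub>C P r"
  using arg_cong[OF P_Q[OF assms], of star] by (simp add: star_mult star_star star_scaleC)

text \<open>\<open>P\<^sub>r\<close> commutes with \<open>Q\<^sub>j\<close>, and \<open>S\<^sub>j Q\<^sub>j = S\<^sub>j\<close>.\<close>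

lemma S_P_Q:
  assumes "r \<in> {1..n}" "j \<in> {1..n}"
  shows "S j * P r * ((S j)\<^sup>\<star> * S j) = S j * P r"
  by (metis P_Q[OF assms] Q_P[OF assms] S_piso[OF assms(2)] mult.assoc)

lemma E_star [simp]: "(E r)\<^sup>\<star> = E r"
  by (simp add: ck_alpha_P_def star_sum star_mult star_star mult.assoc)

text \<open>The defining property of \<open>\<alpha>(P\<^sub>r)\<close>: the adjoints of the generators intertwine \<open>\<alpha>(P\<^sub>r)\<close> with \<open>P\<^sub>r\<close>. It
  makes the \<open>\<alpha>(P\<^sub>r)\<close> orthogonal projections like the \<open>P\<^sub>r\<close>.\<close>

lemma S_star_E:
  assumes "r \<in> {1..n}" "j \<in> {1..n}"
  shows "(S j)\<^sup>\<star> * E r = P r * (S j)\<^sup>\<star>"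
proof -
  have *: "(S j)\<^sup>\<star> * (S k * P r * (S k)\<^sup>\<star>) = (if k = j then P r * (S j)\<^sup>\<star> else 0)"
    if "k \<in> {1..n}" for k
  proof (cases "k = j")
    case True
    have "(S j)\<^sup>\<star> * S j * (P r * (S j)\<^sup>\<star>) = (S j * P r * ((S j)\<^sup>\<star> * S j))\<^sup>\<star>"
      by (simp add: star_mult star_star mult.assoc)
    also have "\<dots> = P r * (S j)\<^sup>\<star>" unfolding S_P_Q[OF assms] by (simp add: star_mult)
    finally show ?thesis using True by (simp add: mult.assoc)
  next
    case False
    with S_star_S[OF assms(2) that] show ?thesis by (simp flip: mult.assoc)
  qed
  have "(S j)\<^sup>\<star> * E r = (\<Sum>k=1..n. if k = j then P r * (S j)\<^sup>\<star> else 0)"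
    unfolding ck_alpha_P_def sum_distrib_left by (rule sum.cong) (use * in auto)
  then show ?thesis using assms by simp
qed

lemma E_mult:
  assumes "r \<in> {1..n}" "t \<in> {1..n}"
  shows "E r * E t = (if r = t then E r else 0)"
proof -
  have "E r * E t = (\<Sum>j=1..n. S j * P r * (P t * (S j)\<^sup>\<star>))"
    unfolding ck_alpha_P_def[of n S r] sum_distrib_right mult.assoc
    by (intro sum.cong refl) (simp only: S_star_E[OF assms(2)])
  also have "\<dots> = (\<Sum>j=1..n. S j * (P r * P t) * (S j)\<^sup>\<star>)" by (simp add: mult.assoc)
  finally show ?thesis using assms by (simp add: P_mult ck_alpha_P_def)
qed

lemma E_sum: "(\<Sum>r=1..n. E r) = 1"
proof -
  have "(\<Sum>r=1..n. E r) = (\<Sum>j=1..n. S j * (\<Sum>r=1..n. P r) * (S j)\<^sup>\<star>)"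
    unfolding ck_alpha_P_def sum_distrib_left sum_distrib_right by (rule sum.swap)
  then show ?thesis by (simp add: P_sum flip: ck_P_def)
qed

text \<open>The element \<open>\<alpha>(\<Sum>\<^sub>r f(r) P\<^sub>r)\<close>. As the \<open>\<alpha>(P\<^sub>r)\<close> form a partition of unity by projections, \<open>f \<mapsto> alpha f\<close>
  is a unital *-homomorphism from functions on \<open>{1..n}\<close>: a ready-made functional calculus for \<open>\<alpha>(Q)\<close>.\<close>

definition alpha :: "(nat \<Rightarrow> complex) \<Rightarrow> 'a" where
  "alpha f = (\<Sum>r=1..n. f r *\<^sub>C E r)"

lemma alpha_cong: "(\<And>r. r \<in> {1..n} \<Longrightarrow> f r = g r) \<Longrightarrow> alpha f = alpha g"
  unfolding alpha_def by (rule sum.cong) auto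

lemma alpha_mult: "alpha f * alpha g = alpha (\<lambda>r. f r * g r)"
proof -
  have "alpha f * alpha g = (\<Sum>r=1..n. \<Sum>t=1..n. if t = r then (f r * g r) *\<^sub>C E r else 0)"
    unfolding alpha_def sum_product
    by (intro sum.cong refl)
      (auto simp: E_mult mult_scaleC_left mult_scaleC_right scaleC_scaleC mult.commute)
  then show ?thesis by (simp add: alpha_def)
qed

lemma alpha_const: "alpha (\<lambda>r. c) = c *\<^sub>C 1"
  by (simp add: alpha_def E_sum flip: scaleC_sum_right)

lemma alpha_diff: "alpha (\<lambda>r. f r - g r) = alpha f - alpha g"
  by (simp add: alpha_def scaleC_diff_left sum_subtractf)

lemma alpha_star: "(alpha f)\<^sup>\<star> = alpha (\<lambda>r. cnj (f r))"
  by (simp add: alpha_def star_sum star_scaleC)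

text \<open>For \<open>l\<close> off the values of \<open>f\<close>, the inverse of \<open>l - alpha f\<close> is \<open>alpha (1 / (l - f))\<close>.\<close>

lemma alpha_positive:
  assumes "\<And>r. r \<in> {1..n} \<Longrightarrow> 0 \<le> f r"
  shows "positive_in UNIV (alpha (\<lambda>r. complex_of_real (f r)))"
  unfolding positive_in_def
proof (intro conjI UNIV_I subsetI)
  show "(alpha (\<lambda>r. complex_of_real (f r)))\<^sup>\<star> = alpha (\<lambda>r. complex_of_real (f r))"
    by (simp add: alpha_star)
  fix l assume l: "l \<in> spectrum_in UNIV (alpha (\<lambda>r. complex_of_real (f r)))"
  show "l \<in> complex_of_real ` {0..}"
  proof (rule ccontr)
    assume "l \<notin> complex_of_real ` {0..}"
    then have ne: "l - complex_of_real (f r) \<noteq> 0" if "r \<in> {1..n}" for r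
      using assms[OF that] by auto
    define b where "b = alpha (\<lambda>r. 1 / (l - complex_of_real (f r)))"
    have eq: "l *\<^sub>C 1 - alpha (\<lambda>r. complex_of_real (f r)) = alpha (\<lambda>r. l - complex_of_real (f r))"
      by (simp add: alpha_diff alpha_const)
    have one: "alpha (\<lambda>r. 1) = 1" by (simp add: alpha_const)
    have "b * alpha (\<lambda>r. l - complex_of_real (f r)) = 1" "alpha (\<lambda>r. l - complex_of_real (f r)) * b = 1"
      unfolding b_def alpha_mult one[symmetric] by (intro alpha_cong; use ne in simp)+
    with l show False by (auto simp: spectrum_in_def eq)
  qed
qed

definition col_sum :: "nat \<Rightarrow> real" where
  "col_sum r = real (\<Sum>i=1..n. A i r)"

lemma col_sum_ge_1: "r \<in> {1..n} \<Longrightarrow> 1 \<le> col_sum r"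
proof -
  assume "r \<in> {1..n}"
  from A_column[OF this] obtain i where i: "i \<in> {1..n}" "A i r \<noteq> 0" by blast
  have "A i r \<le> (\<Sum>i=1..n. A i r)" by (rule member_le_sum) (use i in auto)
  with i(2) have "1 \<le> (\<Sum>i=1..n. A i r)" by linarith
  then show "1 \<le> col_sum r" unfolding col_sum_def by linarith
qed

text \<open>Exchanging the sums over rows and columns of \<open>A\<close> turns \<open>\<alpha>(Q)\<close> into a diagonal element.\<close>

lemma alpha_Q_sum: "(\<Sum>i=1..n. ck_alpha_Q n A S i) = alpha (\<lambda>r. complex_of_real (col_sum r))"
proof -
  have "(\<Sum>i=1..n. ck_alpha_Q n A S i) = (\<Sum>r=1..n. (\<Sum>i=1..n. of_nat (A i r)) * E r)"
    unfolding ck_alpha_Q_def sum_distrib_right by (rule sum.swap)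
  also have "\<dots> = (\<Sum>r=1..n. of_nat (\<Sum>i=1..n. A i r) * E r)" by simp
  also have "\<dots> = alpha (\<lambda>r. complex_of_real (col_sum r))"
    unfolding scaleC_of_nat alpha_def col_sum_def by simp
  finally show ?thesis .
qed

definition sqrt_alpha_Q :: 'a where "sqrt_alpha_Q = alpha (\<lambda>r. complex_of_real (sqrt (col_sum r)))"
definition inv_sqrt_alpha_Q :: 'a where "inv_sqrt_alpha_Q = alpha (\<lambda>r. complex_of_real (1 / sqrt (col_sum r)))"

lemma inv_sqrt_alpha_Q_star [simp]: "inv_sqrt_alpha_Q\<^sup>\<star> = inv_sqrt_alpha_Q"
  by (simp add: inv_sqrt_alpha_Q_def alpha_star)

lemma sqrt_alpha_Q_inverse_right: "sqrt_alpha_Q * inv_sqrt_alpha_Q = 1" and sqrt_alpha_Q_inverse_left: "inv_sqrt_alpha_Q * sqrt_alpha_Q = 1"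
proof -
  have one: "alpha (\<lambda>r. 1) = 1" by (simp add: alpha_const)
  have "sqrt (col_sum r) \<noteq> 0" if "r \<in> {1..n}" for r using col_sum_ge_1[OF that] by simp
  then show "sqrt_alpha_Q * inv_sqrt_alpha_Q = 1" "inv_sqrt_alpha_Q * sqrt_alpha_Q = 1"
    unfolding sqrt_alpha_Q_def inv_sqrt_alpha_Q_def alpha_mult one[symmetric]
    by (intro alpha_cong; simp flip: of_real_mult)+
qed

lemma sqrt_alpha_Q_square: "sqrt_alpha_Q * sqrt_alpha_Q = (\<Sum>i=1..n. ck_alpha_Q n A S i)"
  unfolding sqrt_alpha_Q_def alpha_mult alpha_Q_sum
proof (rule alpha_cong)
  fix r assume "r \<in> {1..n}"
  from col_sum_ge_1[OF this] have "sqrt (col_sum r) * sqrt (col_sum r) = col_sum r" by simp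
  then show "complex_of_real (sqrt (col_sum r)) * complex_of_real (sqrt (col_sum r)) =
      complex_of_real (col_sum r)" by (metis of_real_mult)
qed

text \<open>The diagonal element with coefficients \<open>c\<^sub>r\<^sup>-\<^sup>1\<^sup>/\<^sup>2\<close> has the properties that define the inverse square root. They determine it,
  since it is bounded below by the least of its finitely many positive coefficients.\<close>

lemma inverse_sqrt_alpha_Q: "inverse_sqrt (\<Sum>i=1..n. ck_alpha_Q n A S i) = inv_sqrt_alpha_Q"
  unfolding inverse_sqrt_def
proof (rule the_equality)
  let ?a = "\<Sum>i=1..n. ck_alpha_Q n A S i"
  have pos: "0 < sqrt (col_sum r)" if "r \<in> {1..n}" for r using col_sum_ge_1[OF that] by simp
  have inv: "inv_sqrt_alpha_Q * inv_sqrt_alpha_Q * ?a = 1" "?a * (inv_sqrt_alpha_Q * inv_sqrt_alpha_Q) = 1"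
    unfolding sqrt_alpha_Q_square[symmetric] by (metis sqrt_alpha_Q_inverse_right sqrt_alpha_Q_inverse_left mult.assoc mult.left_neutral)+
  show "positive_in UNIV inv_sqrt_alpha_Q \<and> inv_sqrt_alpha_Q * inv_sqrt_alpha_Q * ?a = 1 \<and> ?a * (inv_sqrt_alpha_Q * inv_sqrt_alpha_Q) = 1"
  proof (intro conjI inv)
    show "positive_in UNIV inv_sqrt_alpha_Q"
      unfolding inv_sqrt_alpha_Q_def using pos by (intro alpha_positive) (meson divide_nonneg_pos zero_le_one)
  qed
  fix b assume b: "positive_in UNIV b \<and> b * b * ?a = 1 \<and> ?a * (b * b) = 1"
  have "b * b = b * b * ?a * (inv_sqrt_alpha_Q * inv_sqrt_alpha_Q)" by (simp only: mult.assoc[of "b * b"] inv mult_1_right)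
  then have "b * b = inv_sqrt_alpha_Q * inv_sqrt_alpha_Q" using b by (simp only: mult_1_left)
  \<comment> \<open>Inserting \<open>1\<close> keeps the set over which the minimum is taken nonempty.\<close>
  define \<epsilon> where "\<epsilon> = Min (insert 1 ((\<lambda>r. 1 / sqrt (col_sum r)) ` {1..n}))"
  have \<epsilon>: "0 < \<epsilon>" unfolding \<epsilon>_def using pos by (subst Min_gr_iff) auto
  have "\<epsilon> \<le> 1 / sqrt (col_sum r)" if "r \<in> {1..n}" for r
    unfolding \<epsilon>_def using that by (intro Min_le) auto
  then have "positive_in UNIV (alpha (\<lambda>r. complex_of_real (1 / sqrt (col_sum r) - \<epsilon>)))"
    by (intro alpha_positive) simp
  moreover have "alpha (\<lambda>r. complex_of_real (1 / sqrt (col_sum r) - \<epsilon>)) = inv_sqrt_alpha_Q - \<epsilon> *\<^sub>R 1"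
    by (simp add: inv_sqrt_alpha_Q_def alpha_diff alpha_const scaleR_scaleC)
  ultimately have "positive_in UNIV (inv_sqrt_alpha_Q - \<epsilon> *\<^sub>R 1)" by simp
  with b \<epsilon> \<open>b * b = inv_sqrt_alpha_Q * inv_sqrt_alpha_Q\<close> show "b = inv_sqrt_alpha_Q" using positive_sqrt_unique by blast
qed

lemma V_eq: "V = inv_sqrt_alpha_Q * (\<Sum>i=1..n. S i)"
  by (simp add: ck_isometry_def inverse_sqrt_alpha_Q)

text \<open>The generators are recovered from the isometry and the core: multiplication by \<open>\<alpha>(Q)\<^sup>1\<^sup>/\<^sup>2\<close> turns \<open>V\<close> into
  \<open>\<Sum>\<^sub>j S\<^sub>j\<close>, and \<open>P\<^sub>i\<close> picks out the summand \<open>S\<^sub>i\<close>.\<close>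

lemma S_eq:
  assumes "i \<in> {1..n}"
  shows "S i = P i * sqrt_alpha_Q * V"
proof -
  have "P i * sqrt_alpha_Q * V = P i * (sqrt_alpha_Q * inv_sqrt_alpha_Q) * (\<Sum>i=1..n. S i)" by (simp add: V_eq mult.assoc)
  also have "\<dots> = (\<Sum>j=1..n. if j = i then S i else 0)"
    unfolding sqrt_alpha_Q_inverse_right mult_1_right sum_distrib_left by (rule sum.cong) (use assms in \<open>auto simp: P_S\<close>)
  finally show ?thesis using assms by simp
qed

text \<open>The off-diagonal terms of \<open>(\<Sum>\<^sub>j S\<^sub>j\<^sup>\<star>) \<alpha>(Q)\<^sup>-\<^sup>1 (\<Sum>\<^sub>k S\<^sub>k)\<close> vanish. The remaining ones add up to
  \<open>\<Sum>\<^sub>j \<Sum>\<^sub>r c\<^sub>r\<^sup>-\<^sup>1 A(j,r) P\<^sub>r = \<Sum>\<^sub>r P\<^sub>r = 1\<close>: the column sums \<open>c\<^sub>r\<close> cancel, which is why \<open>\<alpha>(Q)\<close> is the right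
  normalization.\<close>

lemma V_isometry: "V\<^sup>\<star> * V = 1"
proof -
  define f where "f r = complex_of_real (1 / sqrt (col_sum r)) * complex_of_real (1 / sqrt (col_sum r))" for r
  have f: "f r * of_nat (\<Sum>j=1..n. A j r) = 1" if "r \<in> {1..n}" for r
  proof -
    have "f r = complex_of_real (1 / col_sum r)"
      using col_sum_ge_1[OF that] unfolding f_def of_real_mult[symmetric] by simp
    moreover have "of_nat (\<Sum>j=1..n. A j r) = complex_of_real (col_sum r)" by (simp add: col_sum_def)
    moreover have "col_sum r \<noteq> 0" using col_sum_ge_1[OF that] by simp
    ultimately show ?thesis by (simp flip: of_real_mult)
  qed
  have hh: "inv_sqrt_alpha_Q * inv_sqrt_alpha_Q = alpha f" unfolding inv_sqrt_alpha_Q_def alpha_mult f_def ..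
  have inner: "(S j)\<^sup>\<star> * alpha f * S k = (if k = j then \<Sum>r=1..n. (f r * of_nat (A j r)) *\<^sub>C P r else 0)"
    if "j \<in> {1..n}" "k \<in> {1..n}" for j k
  proof -
    have "(S j)\<^sup>\<star> * alpha f * S k = (\<Sum>r=1..n. f r *\<^sub>C (P r * ((S j)\<^sup>\<star> * S k)))"
      unfolding alpha_def sum_distrib_left sum_distrib_right
      by (intro sum.cong refl) (simp add: mult_scaleC_left mult_scaleC_right S_star_E[OF _ that(1)] mult.assoc)
    also have "\<dots> = (if k = j then \<Sum>r=1..n. (f r * of_nat (A j r)) *\<^sub>C P r else 0)"
    proof (cases "k = j")
      case True
      then have "(\<Sum>r=1..n. f r *\<^sub>C (P r * ((S j)\<^sup>\<star> * S k))) =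
          (\<Sum>r=1..n. (f r * of_nat (A j r)) *\<^sub>C P r)"
        by (intro sum.cong refl) (simp only: P_Q[OF _ that(1)] scaleC_scaleC)
      with True show ?thesis by simp
    qed (simp add: S_star_S[OF that not_sym])
    finally show ?thesis .
  qed
  have "V\<^sup>\<star> * V = (\<Sum>j=1..n. (S j)\<^sup>\<star>) * alpha f * (\<Sum>k=1..n. S k)"
    by (simp add: V_eq star_mult star_sum mult.assoc flip: hh)
  also have "\<dots> = (\<Sum>j=1..n. \<Sum>k=1..n. (S j)\<^sup>\<star> * alpha f * S k)"
    by (rule sum_sandwich)
  also have "\<dots> = (\<Sum>j=1..n. \<Sum>r=1..n. (f r * of_nat (A j r)) *\<^sub>C P r)"
    by (rule sum.cong[OF refl]) (simp add: inner)
  also have "\<dots> = (\<Sum>r=1..n. (f r * of_nat (\<Sum>j=1..n. A j r)) *\<^sub>C P r)"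
  proof (subst sum.swap, intro sum.cong refl)
    fix r
    have "(\<Sum>j\<in>J. (f r * of_nat (A j r)) *\<^sub>C P r) = (f r * of_nat (\<Sum>j\<in>J. A j r)) *\<^sub>C P r"
      for J :: "nat set"
      by (induction J rule: infinite_finite_induct) (auto simp: scaleC_add_left distrib_left)
    then show "(\<Sum>j=1..n. (f r * of_nat (A j r)) *\<^sub>C P r) = (f r * of_nat (\<Sum>j=1..n. A j r)) *\<^sub>C P r" .
  qed
  also have "\<dots> = (\<Sum>r=1..n. P r)" by (intro sum.cong refl) (simp only: f scaleC_one)
  finally show ?thesis by (simp add: P_sum)
qed

end

section \<open>The core and the isometry\<close>

lemma continuous_on_cstar_sandwich:
  fixes x y :: "'a::cstar_algebra"
  shows "continuous_on B (\<lambda>a. x * a * y)"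
  by (intro continuous_intros)

context ck_family
begin

definition core_gens :: "'a set" where
  "core_gens = {ck_word S \<mu> * P i * (ck_word S \<nu>)\<^sup>\<star> |\<mu> \<nu> i.
    set \<mu> \<subseteq> {1..n} \<and> set \<nu> \<subseteq> {1..n} \<and> length \<mu> = length \<nu> \<and> i \<in> {1..n}}"

lemma F_eq: "F = cstar_generated core_gens"
  by (simp add: ck_core_def core_gens_def)

lemma F_subalgebra: "cstar_subalgebra F"
  by (simp add: F_eq cstar_subalgebra_generated)

lemmas F_closed = cstar_subalgebraD[OF F_subalgebra]

lemma core_gens_in_F: "a \<in> core_gens \<Longrightarrow> a \<in> F"
  using cstar_generated_superset by (auto simp: F_eq)

text \<open>The two multiindices of a generator have the same length, so it is built from some \<open>P\<^sub>i\<close> by the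
  steps \<open>a \<mapsto> S\<^sub>j a S\<^sub>k\<^sup>\<star>\<close>.\<close>

lemma core_gens_induct [consumes 1, case_names base step]:
  assumes "a \<in> core_gens"
    and base: "\<And>i. i \<in> {1..n} \<Longrightarrow> R (P i)"
    and step: "\<And>a j k. a \<in> core_gens \<Longrightarrow> R a \<Longrightarrow> j \<in> {1..n} \<Longrightarrow> k \<in> {1..n} \<Longrightarrow> R (S j * a * (S k)\<^sup>\<star>)"
  shows "R a"
proof -
  have "R (ck_word S \<mu> * P i * (ck_word S \<nu>)\<^sup>\<star>)"
    if "length \<mu> = length \<nu>" "set \<mu> \<subseteq> {1..n}" "set \<nu> \<subseteq> {1..n}" "i \<in> {1..n}" for \<mu> \<nu> i
    using that
  proof (induction \<mu> \<nu> rule: list_induct2)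
    case Nil
    then show ?case by (simp add: ck_word_def base)
  next
    case (Cons j \<mu> k \<nu>)
    have eq: "ck_word S (j # \<mu>) * P i * (ck_word S (k # \<nu>))\<^sup>\<star> =
        S j * (ck_word S \<mu> * P i * (ck_word S \<nu>)\<^sup>\<star>) * (S k)\<^sup>\<star>"
      by (simp add: ck_word_def star_mult mult.assoc)
    have "ck_word S \<mu> * P i * (ck_word S \<nu>)\<^sup>\<star> \<in> core_gens"
      unfolding core_gens_def using Cons.hyps Cons.prems
      by (intro CollectI exI[of _ \<mu>] exI[of _ \<nu>] exI[of _ i]) simp
    moreover have "R (ck_word S \<mu> * P i * (ck_word S \<nu>)\<^sup>\<star>)" using Cons.prems by (intro Cons.IH) simp_all
    ultimately show ?case unfolding eq using Cons.prems by (intro step) simp_all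
  qed
  with assms(1) show ?thesis unfolding core_gens_def by blast
qed

lemma P_core_gens: "i \<in> {1..n} \<Longrightarrow> P i \<in> core_gens"
proof -
  assume "i \<in> {1..n}"
  then have "ck_word S [] * P i * (ck_word S [])\<^sup>\<star> \<in> core_gens" unfolding core_gens_def by fastforce
  then show ?thesis by (simp add: ck_word_def)
qed

lemma S_core_gens:
  assumes "a \<in> core_gens" "j \<in> {1..n}" "k \<in> {1..n}"
  shows "S j * a * (S k)\<^sup>\<star> \<in> core_gens"
proof -
  from assms(1) obtain \<mu> \<nu> i where a: "a = ck_word S \<mu> * P i * (ck_word S \<nu>)\<^sup>\<star>"
    "set \<mu> \<subseteq> {1..n}" "set \<nu> \<subseteq> {1..n}" "length \<mu> = length \<nu>" "i \<in> {1..n}"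
    by (auto simp: core_gens_def)
  have "S j * a * (S k)\<^sup>\<star> = ck_word S (j # \<mu>) * P i * (ck_word S (k # \<nu>))\<^sup>\<star>"
    by (simp add: a ck_word_def star_mult mult.assoc)
  moreover have "set (j # \<mu>) \<subseteq> {1..n}" "set (k # \<nu>) \<subseteq> {1..n}" "length (j # \<mu>) = length (k # \<nu>)"
    using a assms by auto
  ultimately show ?thesis unfolding core_gens_def using a(5) by blast
qed

lemma P_F: "i \<in> {1..n} \<Longrightarrow> P i \<in> F"
  by (intro core_gens_in_F P_core_gens)

lemma one_F: "1 \<in> F"
  unfolding P_sum[symmetric] by (intro cstar_subalgebra_sum F_subalgebra P_F)

lemma Q_F: "i \<in> {1..n} \<Longrightarrow> (S i)\<^sup>\<star> * S i \<in> F"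
  unfolding Q_eq scaleC_of_nat by (intro cstar_subalgebra_sum F_subalgebra F_closed P_F)

lemma alpha_F: "alpha f \<in> F"
  unfolding alpha_def ck_alpha_P_def
  by (intro cstar_subalgebra_sum F_subalgebra F_closed core_gens_in_F S_core_gens P_core_gens)

lemma sqrt_alpha_Q_in_core: "sqrt_alpha_Q \<in> F" and inv_sqrt_alpha_Q_in_core: "inv_sqrt_alpha_Q \<in> F"
  by (simp_all add: sqrt_alpha_Q_def inv_sqrt_alpha_Q_def alpha_F)

text \<open>As \<open>V\<close> is an isometry, \<open>a \<mapsto> V a V\<^sup>\<star>\<close> is multiplicative, so it is enough to look at the generators.\<close>

lemma V_F_V_star:
  assumes "a \<in> F"
  shows "V * a * V\<^sup>\<star> \<in> F"
proof -
  let ?B = "{a. V * a * V\<^sup>\<star> \<in> F}"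
  have "core_gens \<subseteq> ?B"
  proof
    fix a assume a: "a \<in> core_gens"
    have "V * a * V\<^sup>\<star> = inv_sqrt_alpha_Q * (\<Sum>j=1..n. \<Sum>k=1..n. S j * a * (S k)\<^sup>\<star>) * inv_sqrt_alpha_Q"
      unfolding sum_sandwich[symmetric] by (simp add: V_eq star_mult star_sum mult.assoc)
    also have "\<dots> \<in> F"
      by (intro F_closed cstar_subalgebra_sum F_subalgebra core_gens_in_F S_core_gens a inv_sqrt_alpha_Q_in_core)
    finally show "a \<in> ?B" by simp
  qed
  moreover have "cstar_subalgebra ?B"
    unfolding cstar_subalgebra_def
  proof (intro conjI allI ballI)
    have "closed ((\<lambda>a. V * a * V\<^sup>\<star>) -` F)"
      by (intro closed_vimage F_closed continuous_on_cstar_sandwich)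
    then show "closed ?B" by (simp add: vimage_def)
    fix x y assume xy: "x \<in> ?B" "y \<in> ?B"
    then show "x + y \<in> ?B" by (simp add: distrib_left distrib_right F_closed)
    have "V * (x * y) * V\<^sup>\<star> = V * x * (V\<^sup>\<star> * V) * y * V\<^sup>\<star>" by (simp add: V_isometry mult.assoc)
    also have "\<dots> = (V * x * V\<^sup>\<star>) * (V * y * V\<^sup>\<star>)" by (simp only: mult.assoc)
    finally show "x * y \<in> ?B" using xy F_closed(4) by simp
  next
    fix c x assume "x \<in> ?B"
    then show "c *\<^sub>C x \<in> ?B" by (simp add: mult_scaleC_left mult_scaleC_right F_closed)
  next
    fix x assume "x \<in> ?B"
    then have "(V * x * V\<^sup>\<star>)\<^sup>\<star> \<in> F" by (simp add: F_closed)
    then show "x\<^sup>\<star> \<in> ?B" by (simp add: star_mult star_star mult.assoc)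
  qed (simp add: F_closed)
  ultimately have "F \<subseteq> ?B" unfolding F_eq by (intro cstar_generated_minimal)
  with assms show ?thesis by blast
qed

text \<open>A single map \<open>a \<mapsto> S\<^sub>j\<^sup>\<star> a S\<^sub>k\<close> is not multiplicative, so the elements that one such map sends into the core need not form
  an algebra. Those that all the maps send into the core do:
  \<open>S\<^sub>j\<^sup>\<star> x y S\<^sub>k = \<Sum>\<^sub>l (S\<^sub>j\<^sup>\<star> x S\<^sub>l) (S\<^sub>l\<^sup>\<star> y S\<^sub>k)\<close>, because \<open>\<Sum>\<^sub>l S\<^sub>l S\<^sub>l\<^sup>\<star> = 1\<close>.\<close>

lemma S_star_F_S:
  assumes "a \<in> F" "j \<in> {1..n}" "k \<in> {1..n}"
  shows "(S j)\<^sup>\<star> * a * S k \<in> F"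
proof -
  let ?B = "{a. \<forall>j\<in>{1..n}. \<forall>k\<in>{1..n}. (S j)\<^sup>\<star> * a * S k \<in> F}"
  have "core_gens \<subseteq> ?B"
  proof
    fix a assume "a \<in> core_gens"
    then show "a \<in> ?B"
    proof (induction rule: core_gens_induct)
      case (base i)
      have "(S j)\<^sup>\<star> * P i * S k \<in> F" if "j \<in> {1..n}" "k \<in> {1..n}" for j k
      proof (cases "j = i \<and> k = i")
        case True
        with base Q_F show ?thesis by (simp add: S_star_P[OF base base])
      next
        case False
        then have "(S j)\<^sup>\<star> * P i * S k = 0"
          using S_star_P[OF that(1) base] S_star_S[OF base that(2)] by auto
        then show ?thesis by (simp add: F_closed)
      qed
      then show ?case by blast
    next
      case (step a l m)
      have "(S j)\<^sup>\<star> * (S l * a * (S m)\<^sup>\<star>) * S k \<in> F" if "j \<in> {1..n}" "k \<in> {1..n}" for j k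
      proof (cases "j = l \<and> k = m")
        case True
        have "(S j)\<^sup>\<star> * (S l * a * (S m)\<^sup>\<star>) * S k = ((S l)\<^sup>\<star> * S l) * a * ((S m)\<^sup>\<star> * S m)"
          using True by (simp add: mult.assoc)
        also have "\<dots> \<in> F" by (intro F_closed Q_F core_gens_in_F step)
        finally show ?thesis .
      next
        case False
        have "(S j)\<^sup>\<star> * (S l * a * (S m)\<^sup>\<star>) * S k = ((S j)\<^sup>\<star> * S l) * a * ((S m)\<^sup>\<star> * S k)"
          by (simp add: mult.assoc)
        also have "\<dots> = 0" using False S_star_S[OF that(1) step.hyps(2)] S_star_S[OF step.hyps(3) that(2)] by auto
        finally show ?thesis by (simp add: F_closed)
      qed
      then show ?case by blast
    qed
  qed
  moreover have "cstar_subalgebra ?B"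
    unfolding cstar_subalgebra_def
  proof (intro conjI allI ballI)
    have "?B = (\<Inter>j\<in>{1..n}. \<Inter>k\<in>{1..n}. (\<lambda>a. (S j)\<^sup>\<star> * a * S k) -` F)" by auto
    moreover have "closed \<dots>"
      by (intro closed_INT ballI closed_vimage F_closed continuous_on_cstar_sandwich)
    ultimately show "closed ?B" by simp
    fix x y assume xy: "x \<in> ?B" "y \<in> ?B"
    then show "x + y \<in> ?B" by (simp add: distrib_left distrib_right F_closed)
    have "(S j)\<^sup>\<star> * (x * y) * S k \<in> F" if "j \<in> {1..n}" "k \<in> {1..n}" for j k
    proof -
      have "(S j)\<^sup>\<star> * (x * y) * S k = (S j)\<^sup>\<star> * x * (\<Sum>l=1..n. P l) * (y * S k)"
        by (simp add: P_sum mult.assoc)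
      also have "\<dots> = (\<Sum>l=1..n. ((S j)\<^sup>\<star> * x * S l) * ((S l)\<^sup>\<star> * y * S k))"
        unfolding sum_distrib_left sum_distrib_right by (simp add: ck_P_def mult.assoc)
      also have "\<dots> \<in> F"
        by (rule cstar_subalgebra_sum[OF F_subalgebra], rule F_closed(4)) (use xy that in blast)+
      finally show ?thesis .
    qed
    then show "x * y \<in> ?B" by blast
  next
    fix c x assume "x \<in> ?B"
    then show "c *\<^sub>C x \<in> ?B" by (simp add: mult_scaleC_left mult_scaleC_right F_closed)
  next
    fix x assume x: "x \<in> ?B"
    have "(S j)\<^sup>\<star> * x\<^sup>\<star> * S k \<in> F" if "j \<in> {1..n}" "k \<in> {1..n}" for j k
    proof -
      have "((S k)\<^sup>\<star> * x * S j)\<^sup>\<star> \<in> F" using x that by (intro F_closed(6)) blast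
      then show ?thesis by (simp add: star_mult star_star mult.assoc)
    qed
    then show "x\<^sup>\<star> \<in> ?B" by blast
  qed (simp add: F_closed)
  ultimately have "F \<subseteq> ?B" unfolding F_eq by (intro cstar_generated_minimal)
  with assms show ?thesis by blast
qed

lemma V_star_F_V:
  assumes "a \<in> F"
  shows "V\<^sup>\<star> * a * V \<in> F"
proof -
  have "V\<^sup>\<star> * a * V = (\<Sum>j=1..n. \<Sum>k=1..n. (S j)\<^sup>\<star> * (inv_sqrt_alpha_Q * a * inv_sqrt_alpha_Q) * S k)"
    unfolding sum_sandwich[symmetric] by (simp add: V_eq star_mult star_sum mult.assoc)
  also have "\<dots> \<in> F"
    by (intro cstar_subalgebra_sum F_subalgebra S_star_F_S F_closed(4) inv_sqrt_alpha_Q_in_core assms)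
  finally show ?thesis .
qed

lemma star_endomorphism_V: "star_endomorphism F (\<lambda>a. V * a * V\<^sup>\<star>)"
  unfolding star_endomorphism_def star_hom_on_def
proof (intro conjI ballI allI)
  fix x y :: 'a
  show "V * (x + y) * V\<^sup>\<star> = V * x * V\<^sup>\<star> + V * y * V\<^sup>\<star>" by (simp add: distrib_left distrib_right)
  have "V * (x * y) * V\<^sup>\<star> = V * x * (V\<^sup>\<star> * V) * y * V\<^sup>\<star>" by (simp add: V_isometry mult.assoc)
  also have "\<dots> = (V * x * V\<^sup>\<star>) * (V * y * V\<^sup>\<star>)" by (simp only: mult.assoc)
  finally show "V * (x * y) * V\<^sup>\<star> = (V * x * V\<^sup>\<star>) * (V * y * V\<^sup>\<star>)" .
qed (auto simp: mult_scaleC_left mult_scaleC_right star_mult star_star mult.assoc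
      intro: V_F_V_star[unfolded mult.assoc])

lemma complete_transfer_operator_V:
  "complete_transfer_operator F (\<lambda>a. V * a * V\<^sup>\<star>) (\<lambda>a. V\<^sup>\<star> * a * V)"
  unfolding complete_transfer_operator_def transfer_operator_def
proof (intro conjI ballI allI impI)
  fix x y :: 'a
  show "V\<^sup>\<star> * (x + y) * V = V\<^sup>\<star> * x * V + V\<^sup>\<star> * y * V" by (simp add: distrib_left distrib_right)
next
  fix x assume x: "positive_in F x"
  then have "x \<in> F" by (simp add: positive_in_def)
  then show "positive_in F (V\<^sup>\<star> * x * V)"
    by (intro positive_in_conjugate F_subalgebra one_F V_isometry x V_star_F_V)
next
  fix a b
  have "V\<^sup>\<star> * (V * a * V\<^sup>\<star> * b) * V = (V\<^sup>\<star> * V) * a * (V\<^sup>\<star> * b * V)" by (simp only: mult.assoc)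
  then show "V\<^sup>\<star> * (V * a * V\<^sup>\<star> * b) * V = a * (V\<^sup>\<star> * b * V)" by (simp only: V_isometry mult_1_left)
qed (auto simp: mult_scaleC_left mult_scaleC_right mult.assoc
      intro: V_star_F_V[unfolded mult.assoc] continuous_on_cstar_sandwich[unfolded mult.assoc])

lemma generated_F_V:
  assumes "cstar_generated (insert 1 (S ` {1..n})) = UNIV"
  shows "cstar_generated (F \<union> {V}) = UNIV"
proof -
  note sub = cstar_subalgebraD[OF cstar_subalgebra_generated[of "F \<union> {V}"]]
  have gen: "F \<union> {V} \<subseteq> cstar_generated (F \<union> {V})" by (rule cstar_generated_superset)
  have "S i \<in> cstar_generated (F \<union> {V})" if "i \<in> {1..n}" for i
    unfolding S_eq[OF that] using gen P_F[OF that] sqrt_alpha_Q_in_core by (intro sub(4)) auto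
  moreover have "1 \<in> cstar_generated (F \<union> {V})" using gen one_F by blast
  ultimately have "insert 1 (S ` {1..n}) \<subseteq> cstar_generated (F \<union> {V})" by blast
  from cstar_generated_minimal[OF cstar_subalgebra_generated this] assms show ?thesis by auto
qed

end

section \<open>Seminorms on the free algebra of the crossed product\<close>

lemma free_scale_of_nat: "free_scale (of_nat k) x = of_nat k * x"
  by (induction k) (auto simp: free_scale_add_left distrib_right)

text \<open>A C*-seminorm on the free *-algebra of the crossed product that respects the relators. The
  assumption that it dominates the seminorm coming from \<open>\<O>\<^sub>A\<close> costs no generality, since the maximum of two C*-seminorms
  is a C*-seminorm; it lets one approximation in \<open>p\<close> serve for both seminorms.\<close>

locale crossed_seminorm = ck_family n A S + free_cstar_seminorm p
  for n :: nat and A :: "nat \<Rightarrow> nat \<Rightarrow> nat" and S :: "nat \<Rightarrow> 'a::cstar_algebra"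
    and p :: "'a crossed_gen free_star_alg \<Rightarrow> real" +
  assumes relators: "r \<in> crossed_relators F (\<lambda>a. V * a * V\<^sup>\<star>) (\<lambda>a. V\<^sup>\<star> * a * V) \<Longrightarrow> p r = 0"
    and dominates: "norm (eval_free (case_crossed_gen (\<lambda>a. a) V) x) \<le> p x"
    and ck_universal: "universal_cstar {1..n} (ck_relators n A) S"
begin

abbreviation e :: "'a \<Rightarrow> 'a crossed_gen free_star_alg" where "e a \<equiv> gen (Elt a)"
abbreviation u :: "'a crossed_gen free_star_alg" where "u \<equiv> gen PIso"

lemma e_add:
  assumes "a \<in> F" "b \<in> F"
  shows "e (a + b) \<doteq> e a + e b"
  unfolding eqv_def by (rule relators) (use assms in \<open>unfold crossed_relators_def, blast\<close>)

lemma e_scale: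
  assumes "a \<in> F"
  shows "e (c *\<^sub>C a) \<doteq> free_scale c (e a)"
  unfolding eqv_def by (rule relators) (use assms in \<open>unfold crossed_relators_def, blast\<close>)

lemma e_mult:
  assumes "a \<in> F" "b \<in> F"
  shows "e (a * b) \<doteq> e a * e b"
  unfolding eqv_def by (rule relators) (use assms in \<open>unfold crossed_relators_def, blast\<close>)

lemma e_star:
  assumes "a \<in> F"
  shows "e (a\<^sup>\<star>) \<doteq> free_star (e a)"
  unfolding eqv_def by (rule relators) (use assms in \<open>unfold crossed_relators_def, blast\<close>)

lemma e_one: "e 1 \<doteq> 1"
  unfolding eqv_def by (rule relators) (unfold crossed_relators_def, blast)

lemma e_endo:
  assumes "a \<in> F"
  shows "e (V * a * V\<^sup>\<star>) \<doteq> u * e a * free_star u"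
  unfolding eqv_def by (rule relators) (use assms in \<open>unfold crossed_relators_def, blast\<close>)

lemma e_transfer:
  assumes "a \<in> F"
  shows "e (V\<^sup>\<star> * a * V) \<doteq> free_star u * e a * u"
  unfolding eqv_def by (rule relators) (use assms in \<open>unfold crossed_relators_def, blast\<close>)

lemma e_zero: "e 0 \<doteq> 0"
  using e_scale[of 0 0] F_closed(2) by simp

lemma e_sum: "(\<And>i. i \<in> I \<Longrightarrow> f i \<in> F) \<Longrightarrow> e (\<Sum>i\<in>I. f i) \<doteq> (\<Sum>i\<in>I. e (f i))"
proof (induction I rule: infinite_finite_induct)
  case (insert i I)
  then have "e (f i + sum f I) \<doteq> e (f i) + e (sum f I)"
    by (intro e_add cstar_subalgebra_sum F_subalgebra) auto
  also have "\<dots> \<doteq> e (f i) + (\<Sum>i\<in>I. e (f i))" using insert by (intro eqv_add) auto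
  finally show ?case using insert by simp
qed (simp_all add: e_zero)

text \<open>The candidate for \<open>S\<^sub>i\<close> in the crossed product, suggested by \<open>S_eq\<close>.\<close>

definition lift :: "nat \<Rightarrow> 'a crossed_gen free_star_alg" where
  "lift i = e (P i * sqrt_alpha_Q) * u"

lemma P_sqrt_alpha_Q_in_core: "i \<in> {1..n} \<Longrightarrow> P i * sqrt_alpha_Q \<in> F"
  by (intro F_closed P_F sqrt_alpha_Q_in_core)

text \<open>The relation \<open>U a U\<^sup>\<star> = \<delta>(a)\<close> absorbs both copies of \<open>U\<close> into the core.\<close>

lemma lift_e_lift_star:
  assumes "i \<in> {1..n}" "j \<in> {1..n}" "a \<in> F"
  shows "lift i * e a * free_star (lift j) \<doteq> e (S i * a * (S j)\<^sup>\<star>)"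
proof -
  have F: "P i * sqrt_alpha_Q \<in> F" "(P j * sqrt_alpha_Q)\<^sup>\<star> \<in> F" "V * a * V\<^sup>\<star> \<in> F"
    using assms by (simp_all add: F_closed(6) P_sqrt_alpha_Q_in_core V_F_V_star)
  note FF = F_closed(4)[OF F(1) F(3)]
  have "lift i * e a * free_star (lift j) = e (P i * sqrt_alpha_Q) * (u * e a * free_star u) * free_star (e (P j * sqrt_alpha_Q))"
    by (simp add: lift_def mult.assoc)
  also have "\<dots> \<doteq> e (P i * sqrt_alpha_Q) * e (V * a * V\<^sup>\<star>) * e ((P j * sqrt_alpha_Q)\<^sup>\<star>)"
    using assms by (intro eqv_mult eqv_refl eqv_sym[OF e_endo] eqv_sym[OF e_star] P_sqrt_alpha_Q_in_core)
  also have "\<dots> \<doteq> e (P i * sqrt_alpha_Q * (V * a * V\<^sup>\<star>)) * e ((P j * sqrt_alpha_Q)\<^sup>\<star>)"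
    by (intro eqv_mult eqv_refl eqv_sym[OF e_mult] F)
  also have "\<dots> \<doteq> e (P i * sqrt_alpha_Q * (V * a * V\<^sup>\<star>) * (P j * sqrt_alpha_Q)\<^sup>\<star>)"
    by (rule eqv_sym[OF e_mult[OF FF F(2)]])
  also have "\<dots> = e (S i * a * (S j)\<^sup>\<star>)"
    by (simp add: S_eq[OF assms(1)] S_eq[OF assms(2)] star_mult mult.assoc)
  finally show ?thesis .
qed

text \<open>Here \<open>U\<^sup>\<star> a U = \<delta>\<^sub>*(a)\<close> absorbs both copies of \<open>U\<close>.\<close>

lemma lift_star_lift:
  assumes "i \<in> {1..n}" "j \<in> {1..n}"
  shows "free_star (lift i) * lift j \<doteq> e ((S i)\<^sup>\<star> * S j)"
proof -
  have F: "(P i * sqrt_alpha_Q)\<^sup>\<star> \<in> F" "P j * sqrt_alpha_Q \<in> F" using assms by (simp_all add: F_closed(6) P_sqrt_alpha_Q_in_core)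
  have "free_star (lift i) * lift j = free_star u * (free_star (e (P i * sqrt_alpha_Q)) * e (P j * sqrt_alpha_Q)) * u"
    by (simp add: lift_def mult.assoc)
  also have "\<dots> \<doteq> free_star u * (e ((P i * sqrt_alpha_Q)\<^sup>\<star>) * e (P j * sqrt_alpha_Q)) * u"
    using assms by (intro eqv_mult eqv_refl eqv_sym[OF e_star] P_sqrt_alpha_Q_in_core)
  also have "\<dots> \<doteq> free_star u * e ((P i * sqrt_alpha_Q)\<^sup>\<star> * (P j * sqrt_alpha_Q)) * u"
    by (intro eqv_mult eqv_refl eqv_sym[OF e_mult] F)
  also have "\<dots> \<doteq> e (V\<^sup>\<star> * ((P i * sqrt_alpha_Q)\<^sup>\<star> * (P j * sqrt_alpha_Q)) * V)"
    by (rule eqv_sym[OF e_transfer[OF F_closed(4)[OF F]]])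
  also have "\<dots> = e ((S i)\<^sup>\<star> * S j)"
    by (simp add: S_eq[OF assms(1)] S_eq[OF assms(2)] star_mult mult.assoc)
  finally show ?thesis .
qed

lemma lift_lift_star:
  assumes "i \<in> {1..n}"
  shows "lift i * free_star (lift i) \<doteq> e (P i)"
proof -
  have "lift i * free_star (lift i) \<doteq> lift i * e 1 * free_star (lift i)"
    using eqv_mult[OF eqv_mult[OF eqv_refl eqv_sym[OF e_one]] eqv_refl, of "lift i" "free_star (lift i)"]
    by simp
  also have "\<dots> \<doteq> e (S i * 1 * (S i)\<^sup>\<star>)" by (intro lift_e_lift_star assms one_F)
  finally show ?thesis by (simp add: ck_P_def)
qed

text \<open>Every Cuntz--Krieger relator involves the generators only through products \<open>S\<^sub>i S\<^sub>i\<^sup>\<star>\<close> and \<open>S\<^sub>i\<^sup>\<star> S\<^sub>i\<close>,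
  times at most one further factor \<open>S\<^sub>i\<close>. The former are congruent to the corresponding elements of the core, where the relations hold.\<close>

lemma lift_ck_relators:
  assumes "r \<in> ck_relators n A"
  shows "free_subst lift r \<doteq> 0"
proof -
  have diff: "x - y \<doteq> 0" if "x \<doteq> y" for x y using that by (simp add: eqv_def)
  have range: "free_subst lift (free_range i) = lift i * free_star (lift i)" for i
    by (simp add: free_range_def)
  from assms consider
      i where "i \<in> {1..n}" "r = gen i * free_star (gen i) * gen i - gen i"
    | i j where "i \<in> {1..n}" "j \<in> {1..n}" "i \<noteq> j" "r = free_range i * free_range j"
    | i where "i \<in> {1..n}"
        "r = free_star (gen i) * gen i - (\<Sum>r=1..n. of_nat (A i r) * free_range r)"
    | "r = (\<Sum>i=1..n. free_range i) - 1"
    unfolding ck_relators_def by blast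
  then show ?thesis
  proof cases
    case (1 i)
    have "lift i * free_star (lift i) * lift i \<doteq> e (P i) * lift i"
      by (intro eqv_mult lift_lift_star 1 eqv_refl)
    also have "\<dots> = e (P i) * e (P i * sqrt_alpha_Q) * u" by (simp add: lift_def mult.assoc)
    also have "\<dots> \<doteq> e (P i * (P i * sqrt_alpha_Q)) * u"
      by (intro eqv_mult eqv_refl eqv_sym[OF e_mult] P_F P_sqrt_alpha_Q_in_core 1)
    also have "\<dots> = lift i" using P_mult[OF 1(1) 1(1)] by (simp add: lift_def flip: mult.assoc)
    finally show ?thesis using 1 by (simp add: diff)
  next
    case (2 i j)
    have "lift i * free_star (lift i) * (lift j * free_star (lift j)) \<doteq> e (P i) * e (P j)"
      by (intro eqv_mult lift_lift_star 2)
    also have "\<dots> \<doteq> e (P i * P j)" by (intro eqv_sym[OF e_mult] P_F 2)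
    also have "\<dots> = e 0" by (simp only: P_orth[OF 2(1-3)])
    also note e_zero
    finally show ?thesis using 2 by (simp only: free_subst_mult range)
  next
    case (3 i)
    have "free_star (lift i) * lift i \<doteq> e ((S i)\<^sup>\<star> * S i)" by (intro lift_star_lift 3)
    also have "\<dots> = e (\<Sum>r=1..n. of_nat (A i r) *\<^sub>C P r)"
      by (simp only: Q_eq[OF 3(1)] scaleC_of_nat)
    also have "\<dots> \<doteq> (\<Sum>r=1..n. e (of_nat (A i r) *\<^sub>C P r))" by (intro e_sum F_closed P_F)
    also have "\<dots> \<doteq> (\<Sum>r=1..n. free_scale (of_nat (A i r)) (lift r * free_star (lift r)))"
      by (intro eqv_sum eqv_trans[OF e_scale] eqv_scale eqv_sym[OF lift_lift_star] P_F)
    finally show ?thesis using 3 by (simp add: diff range free_scale_of_nat)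
  next
    case 4
    have "(\<Sum>r=1..n. lift r * free_star (lift r)) \<doteq> (\<Sum>r=1..n. e (P r))"
      by (intro eqv_sum lift_lift_star)
    also have "\<dots> \<doteq> e (\<Sum>r=1..n. P r)" by (intro eqv_sym[OF e_sum] P_F)
    also have "\<dots> = e 1" by (simp only: P_sum)
    also note e_one
    finally show ?thesis using 4 by (simp add: diff range)
  qed
qed

text \<open>The seminorm \<open>y \<mapsto> p (free_subst lift y)\<close> vanishes on the Cuntz--Krieger relators, so universality
  of \<open>\<O>\<^sub>A\<close> applies to it.\<close>

lemma lift_le:
  assumes "y \<in> free_on {1..n}"
  shows "p (free_subst lift y) \<le> norm (eval_free S y)"
proof -
  have "\<forall>r\<in>ck_relators n A. p (free_subst lift r) = 0"
    using lift_ck_relators by (simp add: eqv_def)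
  with ck_universal cstar_seminorm_subst[of lift] assms show ?thesis
    unfolding universal_cstar_def by blast
qed

lemma e_le:
  assumes "a \<in> F"
  shows "p (e a) \<le> norm a"
proof (rule cstar_seminorm_le_norm[OF F_subalgebra one_F assms])
  fix x y c assume x: "x \<in> F"
  show "p (e (c *\<^sub>C x)) = cmod c * p (e x)" using eqv_p[OF e_scale[OF x]] by (simp add: p_scale)
  have "e (x\<^sup>\<star> * x) \<doteq> free_star (e x) * e x"
    by (rule eqv_trans[OF e_mult[OF F_closed(6)[OF x] x] eqv_mult[OF e_star[OF x] eqv_refl]])
  from eqv_p[OF this] show "p (e (x\<^sup>\<star> * x)) = (p (e x))\<^sup>2" by (simp add: p_cstar)
  assume y: "y \<in> F"
  show "p (e (x + y)) \<le> p (e x) + p (e y)" using eqv_p[OF e_add[OF x y]] p_add by simp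
  show "p (e (x * y)) \<le> p (e x) * p (e y)" using eqv_p[OF e_mult[OF x y]] p_mult by simp
qed

text \<open>The \<open>p\<close>-closure of the *-algebra generated by the lifted generators. The aim is to show that it contains
  all letters of the crossed product.\<close>

definition approximable :: "'a crossed_gen free_star_alg \<Rightarrow> bool" where
  "approximable x \<longleftrightarrow> (\<forall>\<epsilon>>0. \<exists>y\<in>free_on {1..n}. p (x - free_subst lift y) < \<epsilon>)"

lemma approximable_limit:
  assumes "\<And>\<epsilon>. 0 < \<epsilon> \<Longrightarrow> \<exists>x'. approximable x' \<and> p (x - x') < \<epsilon>"
  shows "approximable x"
  unfolding approximable_def
proof (intro allI impI)
  fix \<epsilon> :: real assume "0 < \<epsilon>"
  then obtain x' where x': "approximable x'" "p (x - x') < \<epsilon> / 2" using assms[of "\<epsilon> / 2"] by auto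
  from x'(1) \<open>0 < \<epsilon>\<close> obtain y where y: "y \<in> free_on {1..n}" "p (x' - free_subst lift y) < \<epsilon> / 2"
    unfolding approximable_def by (meson half_gt_zero)
  have "p (x - free_subst lift y) \<le> p (x - x') + p (x' - free_subst lift y)"
    using p_add[of "x - x'" "x' - free_subst lift y"] by simp
  with x' y show "\<exists>y\<in>free_on {1..n}. p (x - free_subst lift y) < \<epsilon>" by force
qed

lemma approximable_eqv: "x \<doteq> x' \<Longrightarrow> approximable x' \<Longrightarrow> approximable x"
  by (rule approximable_limit) (auto simp: eqv_def)

lemma approximable_subst: "y \<in> free_on {1..n} \<Longrightarrow> approximable (free_subst lift y)"
  unfolding approximable_def by (auto intro!: bexI[of _ y])

lemma approximable_lift: "i \<in> {1..n} \<Longrightarrow> approximable (lift i)"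
  using approximable_subst[OF free_on_gen] by force

lemma approximable_zero: "approximable 0" and approximable_one: "approximable 1"
  using approximable_subst[OF free_on_zero] approximable_subst[OF free_on_one] by simp_all

lemma approximable_add:
  assumes "approximable x" "approximable y"
  shows "approximable (x + y)"
  unfolding approximable_def
proof (intro allI impI)
  fix \<epsilon> :: real assume "0 < \<epsilon>"
  then have "0 < \<epsilon> / 2" by simp
  then obtain a b where a: "a \<in> free_on {1..n}" "p (x - free_subst lift a) < \<epsilon> / 2"
    and b: "b \<in> free_on {1..n}" "p (y - free_subst lift b) < \<epsilon> / 2"
    using assms unfolding approximable_def by metis
  have "p (x + y - free_subst lift (a + b)) \<le> p (x - free_subst lift a) + p (y - free_subst lift b)"
    unfolding free_subst_add add_diff_add by (rule p_add)
  with a b show "\<exists>y'\<in>free_on {1..n}. p (x + y - free_subst lift y') < \<epsilon>"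
    by (intro bexI[of _ "a + b"] free_on_add) auto
qed

lemma approximable_scale:
  assumes "approximable x"
  shows "approximable (free_scale c x)"
  unfolding approximable_def
proof (intro allI impI)
  fix \<epsilon> :: real assume "0 < \<epsilon>"
  then have "0 < \<epsilon> / (cmod c + 1)" by (simp add: add_nonneg_pos)
  then obtain a where a: "a \<in> free_on {1..n}" "p (x - free_subst lift a) < \<epsilon> / (cmod c + 1)"
    using assms unfolding approximable_def by metis
  have "p (free_scale c x - free_subst lift (free_scale c a)) = cmod c * p (x - free_subst lift a)"
    by (simp add: p_scale flip: free_scale_diff_right)
  also have "\<dots> \<le> (cmod c + 1) * p (x - free_subst lift a)" by (intro mult_right_mono) auto
  also have "\<dots> < \<epsilon>" using a(2) by (simp add: pos_less_divide_eq add_nonneg_pos mult.commute)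
  finally show "\<exists>y'\<in>free_on {1..n}. p (free_scale c x - free_subst lift y') < \<epsilon>"
    using a(1) free_on_scale by blast
qed

lemma approximable_star: "approximable x \<Longrightarrow> approximable (free_star x)"
  unfolding approximable_def
proof (intro allI impI)
  fix \<epsilon> :: real assume x: "\<forall>\<epsilon>>0. \<exists>y\<in>free_on {1..n}. p (x - free_subst lift y) < \<epsilon>" and "0 < \<epsilon>"
  then obtain y where y: "y \<in> free_on {1..n}" "p (x - free_subst lift y) < \<epsilon>" by blast
  have "p (free_star x - free_subst lift (free_star y)) = p (x - free_subst lift y)"
    by (simp flip: free_star_diff)
  with y show "\<exists>y\<in>free_on {1..n}. p (free_star x - free_subst lift y) < \<epsilon>"
    by (intro bexI[of _ "free_star y"] free_on_star) auto
qed

lemma approximable_mult: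
  assumes "approximable x" "approximable y"
  shows "approximable (x * y)"
  unfolding approximable_def
proof (intro allI impI)
  fix \<epsilon> :: real assume \<epsilon>: "0 < \<epsilon>"
  define K where "K = p x + p y + 1"
  have K: "0 < K" by (simp add: K_def add_nonneg_pos)
  define d where "d = min 1 (\<epsilon> / K)"
  have d: "0 < d" "d \<le> 1" "d * K \<le> \<epsilon>" using \<epsilon> K by (auto simp: d_def min_def field_simps)
  obtain a b where a: "a \<in> free_on {1..n}" "p (x - free_subst lift a) < d"
    and b: "b \<in> free_on {1..n}" "p (y - free_subst lift b) < d"
    using assms d(1) unfolding approximable_def by metis
  define x' y' where "x' = free_subst lift a" and "y' = free_subst lift b"
  have "p x' \<le> p x + p (x - x')" using p_diff[of x "x - x'"] by simp
  then have x': "p x' \<le> p x + 1" using a d by (simp add: x'_def)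
  have "p (x * y - x' * y') = p ((x - x') * y + x' * (y - y'))" by (simp add: algebra_simps)
  also have "\<dots> \<le> p (x - x') * p y + p x' * p (y - y')"
    by (intro order.trans[OF p_add] add_mono p_mult)
  also have "\<dots> \<le> d * p y + (p x + 1) * p (y - y')"
    using a(2) x' by (intro add_mono mult_right_mono) (auto simp: x'_def)
  also have "\<dots> < d * p y + (p x + 1) * d"
    using b(2) by (simp add: y'_def add_nonneg_pos)
  also have "\<dots> = d * K" by (simp add: K_def algebra_simps)
  also note d(3)
  finally show "\<exists>z\<in>free_on {1..n}. p (x * y - free_subst lift z) < \<epsilon>"
    using a b by (intro bexI[of _ "a * b"] free_on_mult) (auto simp: x'_def y'_def)
qed

lemma approximable_sum: "(\<And>i. i \<in> I \<Longrightarrow> approximable (f i)) \<Longrightarrow> approximable (\<Sum>i\<in>I. f i)"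
  by (induction I rule: infinite_finite_induct) (auto intro: approximable_zero approximable_add)

text \<open>The elements of the core whose letters are approximable form a C*-subalgebra; it is closed because
  \<open>p\<close> is continuous on the core (\<open>e_le\<close>). It contains the generators of the core by \<open>lift_e_lift_star\<close>.\<close>

lemma approximable_e:
  assumes "a \<in> F"
  shows "approximable (e a)"
proof -
  let ?C = "{a \<in> F. approximable (e a)}"
  have "core_gens \<subseteq> ?C"
  proof
    fix a assume a: "a \<in> core_gens"
    then have "approximable (e a)"
    proof (induction rule: core_gens_induct)
      case (base i)
      have "e (P i) \<doteq> lift i * free_star (lift i)" by (intro eqv_sym[OF lift_lift_star] base)
      then show ?case
        by (rule approximable_eqv) (intro approximable_mult approximable_star approximable_lift base)
    next
      case (step a j k)
      have "e (S j * a * (S k)\<^sup>\<star>) \<doteq> lift j * e a * free_star (lift k)"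
        by (intro eqv_sym[OF lift_e_lift_star] core_gens_in_F step)
      then show ?case
        by (rule approximable_eqv)
          (intro approximable_mult approximable_star approximable_lift step)
    qed
    with core_gens_in_F[OF a] show "a \<in> ?C" by blast
  qed
  moreover have "cstar_subalgebra ?C"
    unfolding cstar_subalgebra_def
  proof (intro conjI allI ballI)
    show "closed ?C"
      unfolding closed_sequential_limits
    proof (intro allI impI, elim conjE)
      fix X l assume X: "\<forall>k. X k \<in> ?C" and l: "X \<longlonglongrightarrow> l"
      have lF: "l \<in> F" by (rule closed_sequentially[OF F_closed(1) _ l]) (use X in blast)
      have "approximable (e l)"
      proof (rule approximable_limit)
        fix \<epsilon> :: real assume "0 < \<epsilon>"
        with l obtain k where k: "norm (X k - l) < \<epsilon>" unfolding LIMSEQ_iff by blast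
        have XF: "X k \<in> F" using X by blast
        have lX: "l - X k \<in> F" by (intro F_closed lF XF)
        have "e l \<doteq> e (l - X k) + e (X k)" using e_add[OF lX XF] by simp
        then have "p (e l - e (X k)) = p (e (l - X k))"
          by (intro eqv_p) (simp add: eqv_def algebra_simps)
        also have "\<dots> \<le> norm (l - X k)" by (rule e_le[OF lX])
        finally have "p (e l - e (X k)) < \<epsilon>" using k by (simp add: norm_minus_commute)
        with X show "\<exists>x'. approximable x' \<and> p (e l - x') < \<epsilon>" by blast
      qed
      with lF show "l \<in> ?C" by blast
    qed
    show "0 \<in> ?C" by (simp add: F_closed(2) approximable_eqv[OF e_zero approximable_zero])
    fix x y assume "x \<in> ?C" "y \<in> ?C"
    then have x: "x \<in> F" "approximable (e x)" and y: "y \<in> F" "approximable (e y)" by simp_all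
    from x y show "x + y \<in> ?C"
      using approximable_eqv[OF e_add approximable_add] by (simp add: F_closed(3))
    from x y show "x * y \<in> ?C"
      using approximable_eqv[OF e_mult approximable_mult] by (simp add: F_closed(4))
  next
    fix c x assume "x \<in> ?C"
    then have x: "x \<in> F" "approximable (e x)" by simp_all
    from x show "c *\<^sub>C x \<in> ?C"
      using approximable_eqv[OF e_scale approximable_scale] by (simp add: F_closed(5))
    from x show "x\<^sup>\<star> \<in> ?C"
      using approximable_eqv[OF e_star approximable_star] by (simp add: F_closed(6))
  qed
  ultimately have "F \<subseteq> ?C" unfolding F_eq by (intro cstar_generated_minimal)
  with assms show ?thesis by blast
qed

text \<open>\<open>U\<close> is congruent to \<open>\<alpha>(Q)\<^sup>-\<^sup>1\<^sup>/\<^sup>2 \<Sum>\<^sub>i s\<^sub>i\<close>, just as \<open>V = \<alpha>(Q)\<^sup>-\<^sup>1\<^sup>/\<^sup>2 \<Sum>\<^sub>i S\<^sub>i\<close>.\<close>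

lemma approximable_u: "approximable u"
proof -
  have "e inv_sqrt_alpha_Q * (\<Sum>i=1..n. lift i) = e inv_sqrt_alpha_Q * (\<Sum>i=1..n. e (P i * sqrt_alpha_Q)) * u"
    by (simp add: lift_def mult.assoc flip: sum_distrib_right)
  also have "\<dots> \<doteq> e inv_sqrt_alpha_Q * e (\<Sum>i=1..n. P i * sqrt_alpha_Q) * u"
    by (intro eqv_mult eqv_refl eqv_sym[OF e_sum] P_sqrt_alpha_Q_in_core)
  also have "\<dots> = e inv_sqrt_alpha_Q * e sqrt_alpha_Q * u" using P_sum by (simp flip: sum_distrib_right)
  also have "\<dots> \<doteq> e (inv_sqrt_alpha_Q * sqrt_alpha_Q) * u"
    by (intro eqv_mult eqv_refl eqv_sym[OF e_mult] sqrt_alpha_Q_in_core inv_sqrt_alpha_Q_in_core)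
  also have "\<dots> \<doteq> 1 * u" unfolding sqrt_alpha_Q_inverse_left by (intro eqv_mult eqv_refl e_one)
  finally have "u \<doteq> e inv_sqrt_alpha_Q * (\<Sum>i=1..n. lift i)" by (simp add: eqv_sym)
  then show ?thesis
    by (rule approximable_eqv)
      (intro approximable_mult approximable_e inv_sqrt_alpha_Q_in_core approximable_sum approximable_lift)
qed

text \<open>Approximate \<open>x\<close> by an element \<open>y\<close> of the *-algebra of the lifted generators. The inequality holds for \<open>y\<close> by
  \<open>lift_le\<close>, and both sides are continuous in \<open>p\<close>.\<close>

lemma crossed_le:
  assumes "x \<in> free_on (Elt ` F \<union> {PIso})"
  shows "p x \<le> norm (eval_free (case_crossed_gen (\<lambda>a. a) V) x)"
proof -
  let ?g = "case_crossed_gen (\<lambda>a. a) V"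
  have x: "approximable x"
  proof (rule free_on_minimal[OF assms _ approximable_one approximable_zero approximable_add
        approximable_mult approximable_scale approximable_star])
    fix i :: "'a crossed_gen" assume "i \<in> Elt ` F \<union> {PIso}"
    then show "approximable (gen i)" using approximable_e approximable_u by blast
  qed
  show ?thesis
  proof (rule field_le_epsilon)
    fix \<epsilon> :: real assume "0 < \<epsilon>"
    then obtain y where y: "y \<in> free_on {1..n}" "p (x - free_subst lift y) < \<epsilon> / 2"
      using x unfolding approximable_def by (meson half_gt_zero)
    have "eval_free ?g (free_subst lift y) = eval_free S y"
      unfolding eval_free_subst using y(1)
      by (rule eval_free_cong_on) (simp add: lift_def S_eq[symmetric])
    then have "norm (eval_free S y) \<le> norm (eval_free ?g x) + norm (eval_free ?g (x - free_subst lift y))"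
      using norm_triangle_ineq4[of "eval_free ?g x" "eval_free ?g (x - free_subst lift y)"] by simp
    moreover have "norm (eval_free ?g (x - free_subst lift y)) \<le> p (x - free_subst lift y)"
      by (rule dominates)
    moreover have "p x \<le> p (x - free_subst lift y) + p (free_subst lift y)"
      using p_add[of "x - free_subst lift y" "free_subst lift y"] by simp
    ultimately show "p x \<le> norm (eval_free ?g x) + \<epsilon>" using lift_le[OF y(1)] y(2) by linarith
  qed
qed

end

section \<open>Universality of the pair of the core and the isometry\<close>

lemma (in ck_family) eval_crossed_relators:
  assumes "r \<in> crossed_relators F (\<lambda>a. V * a * V\<^sup>\<star>) (\<lambda>a. V\<^sup>\<star> * a * V)"
  shows "eval_free (case_crossed_gen (\<lambda>a. a) V) r = 0"
  using assms unfolding crossed_relators_def by (auto simp: V_isometry mult.assoc)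

lemma (in ck_family) crossed_product_V:
  assumes univ: "universal_cstar {1..n} (ck_relators n A) S"
  shows "crossed_product F (\<lambda>a. V * a * V\<^sup>\<star>) (\<lambda>a. V\<^sup>\<star> * a * V) (\<lambda>a. a) V"
  unfolding crossed_product_def universal_cstar_def
proof (intro conjI allI ballI impI)
  let ?g = "case_crossed_gen (\<lambda>a. a) V" and ?R = "crossed_relators F (\<lambda>a. V * a * V\<^sup>\<star>) (\<lambda>a. V\<^sup>\<star> * a * V)"
  show "eval_free ?g r = 0" if "r \<in> ?R" for r by (rule eval_crossed_relators[OF that])
  have "insert 1 (?g ` (Elt ` F \<union> {PIso})) = F \<union> {V}" using one_F by (auto simp: image_iff)
  then show "cstar_generated (insert 1 (?g ` (Elt ` F \<union> {PIso}))) = UNIV"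
    using generated_F_V univ by (simp add: universal_cstar_def)
  fix p x assume p: "cstar_seminorm p \<and> (\<forall>r\<in>?R. p r = 0)" and x: "x \<in> free_on (Elt ` F \<union> {PIso})"
  let ?p = "\<lambda>x. max (p x) (norm (eval_free ?g x))"
  interpret crossed_seminorm n A S ?p
  proof unfold_locales
    show "cstar_seminorm ?p" using p by (intro cstar_seminorm_max cstar_seminorm_eval) auto
    show "?p r = 0" if "r \<in> ?R" for r using that p eval_crossed_relators by simp
  qed (use univ in auto)
  show "p x \<le> norm (eval_free ?g x)" using crossed_le[OF x] by simp
qed

section \<open>Uniqueness of universal C*-algebras\<close>

lemma universal_cstar_endomorphism_id:
  fixes g :: "'g \<Rightarrow> 'a::cstar_algebra"
  assumes univ: "universal_cstar G R g" and f: "star_hom_on UNIV f" "f 1 = 1" "\<And>x. norm (f x) \<le> norm x"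
    and gen: "\<And>x. x \<in> G \<Longrightarrow> f (g x) = g x"
  shows "f x = x"
proof -
  have hom: "f (x + y) = f x + f y" "f (x * y) = f x * f y" "f (c *\<^sub>C x) = c *\<^sub>C f x"
    "f (x\<^sup>\<star>) = (f x)\<^sup>\<star>" for x y c using f(1) by (auto simp: star_hom_on_def)
  have zero: "f 0 = 0" using hom(1)[of 0 0] by simp
  have minus: "f (x - y) = f x - f y" for x y using hom(1)[of "x - y" y] by simp
  have "1-lipschitz_on UNIV f"
    using f(3) by (intro lipschitz_onI) (simp_all add: dist_norm flip: minus)
  then have "continuous_on UNIV f" by (rule lipschitz_on_continuous_on)
  then have "closed {x. f x = x}" by (intro closed_Collect_eq continuous_on_id)
  then have "cstar_subalgebra {x. f x = x}" by (simp add: cstar_subalgebra_def hom zero)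
  then have "cstar_generated (insert 1 (g ` G)) \<subseteq> {x. f x = x}"
    using f(2) gen by (intro cstar_generated_minimal) auto
  then show ?thesis using univ by (auto simp: universal_cstar_def)
qed

lemma universal_cstar_unique:
  fixes g :: "'g \<Rightarrow> 'a::cstar_algebra" and g' :: "'g \<Rightarrow> 'b::cstar_algebra"
  assumes univ: "universal_cstar G R g" "universal_cstar G R g'"
  shows "\<exists>\<phi>. star_isomorphism UNIV UNIV \<phi> \<and> (\<forall>x\<in>G. \<phi> (g x) = g' x)"
proof -
  have rel: "\<forall>r\<in>R. eval_free g r = 0" "\<forall>r\<in>R. eval_free g' r = 0"
    using univ by (simp_all add: universal_cstar_def)
  obtain \<phi> where \<phi>: "star_hom_on UNIV \<phi>" "\<phi> 1 = 1" "\<forall>x\<in>G. \<phi> (g x) = g' x" "\<And>x. norm (\<phi> x) \<le> norm x"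
    using universal_cstar_hom[OF univ(1) rel(2)] by metis
  obtain \<psi> where \<psi>: "star_hom_on UNIV \<psi>" "\<psi> 1 = 1" "\<forall>x\<in>G. \<psi> (g' x) = g x" "\<And>x. norm (\<psi> x) \<le> norm x"
    using universal_cstar_hom[OF univ(2) rel(1)] by metis
  have le: "norm (\<psi> (\<phi> x)) \<le> norm x" "norm (\<phi> (\<psi> y)) \<le> norm y" for x y
    using \<phi>(4) \<psi>(4) order.trans by blast+
  have "\<psi> (\<phi> x) = x" for x
    by (rule universal_cstar_endomorphism_id[OF univ(1), of "\<lambda>x. \<psi> (\<phi> x)"])
      (use \<phi> \<psi> le in \<open>auto simp: star_hom_on_def\<close>)
  moreover have "\<phi> (\<psi> x) = x" for x
    by (rule universal_cstar_endomorphism_id[OF univ(2), of "\<lambda>x. \<phi> (\<psi> x)"])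
      (use \<phi> \<psi> le in \<open>auto simp: star_hom_on_def\<close>)
  ultimately have "bij \<phi>" by (intro o_bij[of \<psi>]) auto
  with \<phi> show ?thesis unfolding star_isomorphism_def by blast
qed

section \<open>The Cuntz--Krieger algebra as a crossed product\<close>

theorem proposition4p6:
  fixes n :: nat and A :: "nat \<Rightarrow> nat \<Rightarrow> nat"
    and S :: "nat \<Rightarrow> 'a::cstar_algebra" and F :: "'a set" and V :: 'a
    and \<delta> \<delta>\<^sub>s :: "'a \<Rightarrow> 'a"
  assumes "n \<ge> 1"
    and "\<forall>i\<in>{1..n}. \<forall>j\<in>{1..n}. A i j \<in> {0, 1}"
    and "\<forall>i\<in>{1..n}. \<exists>j\<in>{1..n}. A i j \<noteq> 0"
    and "\<forall>j\<in>{1..n}. \<exists>i\<in>{1..n}. A i j \<noteq> 0"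
    and "cuntz_krieger n A S"
    and "F = ck_core n S"
    and "V = ck_isometry n A S"
    and "\<delta> = (\<lambda>a. V * a * V\<^sup>\<star>)"
    and "\<delta>\<^sub>s = (\<lambda>a. V\<^sup>\<star> * a * V)"
  shows "star_endomorphism F \<delta> \<and> complete_transfer_operator F \<delta> \<delta>\<^sub>s \<and>
    cstar_generated (F \<union> {V}) = UNIV \<and>
    crossed_product F \<delta> \<delta>\<^sub>s (\<lambda>a. a) V \<and>
    (\<forall>(\<iota> :: 'a \<Rightarrow> 'b::cstar_algebra) U. crossed_product F \<delta> \<delta>\<^sub>s \<iota> U \<longrightarrow>
      (\<exists>\<phi>. star_isomorphism (cstar_generated (F \<union> {V})) (UNIV :: 'b set) \<phi> \<and>
        \<phi> V = U \<and> (\<forall>a\<in>F. \<phi> a = \<iota> a)))"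
proof -
  interpret ck: ck_family n A S
    using assms(2,4) cuntz_krieger_relations[OF assms(5)] by unfold_locales auto
  have univ: "universal_cstar {1..n} (ck_relators n A) S"
    using assms(5) by (simp add: cuntz_krieger_def)
  then have gen: "cstar_generated (F \<union> {V}) = UNIV"
    using ck.generated_F_V by (simp add: universal_cstar_def assms(6,7))
  have cp: "crossed_product F \<delta> \<delta>\<^sub>s (\<lambda>a. a) V"
    using ck.crossed_product_V[OF univ] by (simp add: assms(6-9))
  have "\<exists>\<phi>. star_isomorphism (cstar_generated (F \<union> {V})) (UNIV :: 'b set) \<phi> \<and>
      \<phi> V = U \<and> (\<forall>a\<in>F. \<phi> a = \<iota> a)"
    if cp': "crossed_product F \<delta> \<delta>\<^sub>s \<iota> U" for \<iota> :: "'a \<Rightarrow> 'b" and U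
  proof -
    obtain \<phi> where "star_isomorphism UNIV UNIV \<phi>"
      "\<forall>x\<in>Elt ` F \<union> {PIso}. \<phi> (case_crossed_gen (\<lambda>a. a) V x) = case_crossed_gen \<iota> U x"
      using universal_cstar_unique[OF cp[unfolded crossed_product_def] cp'[unfolded crossed_product_def]]
      by blast
    then show ?thesis unfolding gen by (intro exI[of _ \<phi>]) auto
  qed
  with gen cp show ?thesis
    using ck.star_endomorphism_V ck.complete_transfer_operator_V by (simp add: assms(6-9))
qed

end
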